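(* Let $\Theta\subseteq\mathbb{R}^L$ be open, let $\mathcal{X}$ be a finite alphabet, and let $(\rho_{XA}(\theta))_{\theta\in\Theta}$ be a parameterized family of second-order differentiable, positive definite, classical-quantum states $$\rho_{XA}(\theta):=\sum_{x\in\mathcal{X}}p_\theta(x)|x\rangle\!\langle x|\otimes\rho_x(\theta),$$ where $(p_\theta)_{\theta\in\Theta}$ is a parameterized family of probability distributions on $\mathcal{X}$ and, for all $x\in\mathcal{X}$, $(\rho_x(\theta))_{\theta\in\Theta}$ is a parameterized family of quantum states. For all $\alpha\in(0,1)\cup(1,\infty)$ and $z>0$, $$I_{\alpha,z}(\theta;(\rho_{XA}(\theta))_{\theta\in\Theta})=I_F(\theta;(p_\theta)_{\theta\in\Theta})+\sum_{x\in\mathcal{X}}p_\theta(x)\,I_{\alpha,z}(\theta;(\rho_x(\theta))_{\theta\in\Theta}).$$ Also, $$I_{\mathrm{KM}}(\theta;(\rho_{XA}(\theta))_{\theta\in\Theta})=I_F(\theta;(p_\theta)_{\theta\in\Theta})+\sum_{x\in\mathcal{X}}p_\theta(x)\,I_{\mathrm{KM}}(\theta;(\rho_x(\theta))_{\theta\in\Theta}),$$ $$I_{\mathrm{RLD}}(\theta;(\rho_{XA}(\theta))_{\theta\in\Theta})=I_F(\theta;(p_\theta)_{\theta\in\Theta})+\sum_{x\in\mathcal{X}}p_\theta(x)\,I_{\mathrm{RLD}}(\theta;(\rho_x(\theta))_{\theta\in\Theta}).$$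
   Context: States are unit-trace positive semi-definite operators on finite-dimensional Hilbert spaces; $\{|x\rangle\}_{x\in\mathcal{X}}$ is an orthonormal basis. For a second-order differentiable family $(\rho(\theta))_{\theta\in\Theta}$ of positive definite states, the following $L\times L$ matrices are defined (the second argument indicates the family on which they are evaluated), with $\partial_i=\partial/\partial\theta_i$: - $\alpha$-$z$ information matrix: $[I_{\alpha,z}(\theta;(\rho(\theta))_{\theta\in\Theta})]_{i,j}:=\frac1\alpha\left.\frac{\partial^2}{\partial\varepsilon_i\partial\varepsilon_j}D_{\alpha,z}(\rho(\theta)\|\rho(\theta+\varepsilon))\right|_{\varepsilon=0}$, where $D_{\alpha,z}(\rho\|\sigma):=\frac{1}{\alpha-1}\ln\mathrm{Tr}\big[(\sigma^{\frac{1-\alpha}{2z}}\rho^{\frac\alpha z}\sigma^{\frac{1-\alpha}{2z}})^z\big]$. - Kubo--Mori information matrix: $[I_{\mathrm{KM}}(\theta;(\rho(\theta))_{\theta\in\Theta})]_{i,j}:=\left.\frac{\partial^2}{\partial\varepsilon_i\partial\varepsilon_j}D(\rho(\theta)\|\rho(\theta+\varepsilon))\right|_{\varepsilon=0}$, where $D(\rho\|\sigma):=\mathrm{Tr}[\rho(\ln\rho-\ln\sigma)]$. - RLD information matrix: $[I_{\mathrm{RLD}}(\theta;(\rho(\theta))_{\theta\in\Theta})]_{i,j}:=\frac12\mathrm{Tr}[\{\partial_i\rho(\theta),\partial_j\rho(\theta)\}\rho(\theta)^{-1}]$, with $\{A,B\}=AB+BA$. The classical Fisher information matrix is $[I_F(\theta;(p_\theta)_{\theta\in\Theta})]_{i,j}:=\sum_{x\in\mathcal{X}}\frac{1}{p_\theta(x)}(\partial_ip_\theta(x))(\partial_jp_\theta(x))$.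 *)

theory Defs
  imports "HOL-Analysis.Analysis"
begin

text \<open>
  Operators on an n-dimensional Hilbert space are matrices of type complex^'n^'n; a tensor product
  space is indexed by pairs of indices. The complex inner product below is
  antilinear in its first argument; the real inner product that the library provides on
  complex^'n is its real part.
\<close>

definition cinner :: "complex^'n \<Rightarrow> complex^'n \<Rightarrow> complex" where
  "cinner v w = (\<Sum>i\<in>UNIV. cnj (v $ i) * w $ i)"

definition dagger :: "complex^'n^'m \<Rightarrow> complex^'m^'n" where
  "dagger A = map_matrix cnj (transpose A)"

definition hermitian :: "complex^'n^'n \<Rightarrow> bool" where
  "hermitian A \<longleftrightarrow> dagger A = A"

definition unitary :: "complex^'n^'n \<Rightarrow> bool" where
  "unitary U \<longleftrightarrow> dagger U ** U = mat 1 \<and> U ** dagger U = mat 1"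

definition pos_semidef :: "complex^'n^'n \<Rightarrow> bool" where
  "pos_semidef A \<longleftrightarrow> hermitian A \<and> (\<forall>v. 0 \<le> Re (cinner v (A *v v)))"

definition pos_def :: "complex^'n^'n \<Rightarrow> bool" where
  "pos_def A \<longleftrightarrow> hermitian A \<and> (\<forall>v. v \<noteq> 0 \<longrightarrow> 0 < Re (cinner v (A *v v)))"

definition quantum_state :: "complex^'n^'n \<Rightarrow> bool" where
  "quantum_state \<rho> \<longleftrightarrow> pos_semidef \<rho> \<and> trace \<rho> = 1"

definition kron :: "complex^'m^'m \<Rightarrow> complex^'n^'n \<Rightarrow> complex^('m \<times> 'n)^('m \<times> 'n)" where
  "kron A B = (\<chi> r c. A $ fst r $ fst c * B $ snd r $ snd c)"

definition ketbra :: "complex^'n \<Rightarrow> complex^'n \<Rightarrow> complex^'n^'n" where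
  "ketbra v w = (\<chi> i j. v $ i * cnj (w $ j))"

text \<open>
  The family is indexed by the same type as the coordinates, so orthonormality already
  makes it a basis.
\<close>

definition orthonormal_basis :: "('x \<Rightarrow> complex^'x) \<Rightarrow> bool" where
  "orthonormal_basis ket \<longleftrightarrow> (\<forall>x y. cinner (ket x) (ket y) = (if x = y then 1 else 0))"

definition cq_state ::
  "('x::finite \<Rightarrow> complex^'x) \<Rightarrow> ('x \<Rightarrow> real) \<Rightarrow> ('x \<Rightarrow> complex^'a^'a)
    \<Rightarrow> complex^('x \<times> 'a)^('x \<times> 'a)" where
  "cq_state ket q \<tau> = (\<Sum>x\<in>UNIV. q x *\<^sub>R kron (ketbra (ket x) (ket x)) (\<tau> x))"

text \<open>
  Functional calculus of a Hermitian matrix: if A = U diag(d) U* with U unitary and d real, then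
  f(A) = U diag(f d) U*, which does not depend on the chosen diagonalization. Only positive
  definite arguments matter here, so the values of \<open>powr\<close> and \<open>ln\<close> at 0 are irrelevant.
\<close>

definition diag_mat :: "('n \<Rightarrow> real) \<Rightarrow> complex^'n^'n" where
  "diag_mat d = (\<chi> i j. if i = j then complex_of_real (d i) else 0)"

definition mat_fun :: "(real \<Rightarrow> real) \<Rightarrow> complex^'n^'n \<Rightarrow> complex^'n^'n" where
  "mat_fun f A = (THE B. \<exists>U d. unitary U \<and> A = U ** diag_mat d ** dagger U \<and>
                               B = U ** diag_mat (f \<circ> d) ** dagger U)"

definition mat_powr :: "complex^'n^'n \<Rightarrow> real \<Rightarrow> complex^'n^'n" where
  "mat_powr A s = mat_fun (\<lambda>t. t powr s) A"

definition mat_ln :: "complex^'n^'n \<Rightarrow> complex^'n^'n" where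
  "mat_ln A = mat_fun ln A"

text \<open>
  For Hermitian arguments all traces in the following definitions are real, so that taking the
  real part is only a conversion of types.
\<close>

definition alpha_z_divergence :: "real \<Rightarrow> real \<Rightarrow> complex^'n^'n \<Rightarrow> complex^'n^'n \<Rightarrow> real" where
  "alpha_z_divergence \<alpha> z \<rho> \<sigma> =
     1 / (\<alpha> - 1) * ln (Re (trace (mat_powr
       (mat_powr \<sigma> ((1 - \<alpha>) / (2 * z)) ** mat_powr \<rho> (\<alpha> / z) ** mat_powr \<sigma> ((1 - \<alpha>) / (2 * z)))
       z)))"

definition relative_entropy :: "complex^'n^'n \<Rightarrow> complex^'n^'n \<Rightarrow> real" where
  "relative_entropy \<rho> \<sigma> = Re (trace (\<rho> ** (mat_ln \<rho> - mat_ln \<sigma>)))"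

definition partial_deriv :: "'l \<Rightarrow> (real^'l \<Rightarrow> 'b::real_normed_vector) \<Rightarrow> real^'l \<Rightarrow> 'b" where
  "partial_deriv i f \<theta> = vector_derivative (\<lambda>t. f (\<theta> + t *\<^sub>R axis i 1)) (at 0)"

definition twice_differentiable_on ::
  "('a::real_normed_vector \<Rightarrow> 'b::real_normed_vector) \<Rightarrow> 'a set \<Rightarrow> bool" where
  "twice_differentiable_on f S \<longleftrightarrow>
     (\<exists>f' :: 'a \<Rightarrow> 'a \<Rightarrow>\<^sub>L 'b.
        (\<forall>x\<in>S. (f has_derivative blinfun_apply (f' x)) (at x within S)) \<and> f' differentiable_on S)"

definition alpha_z_information ::
  "real \<Rightarrow> real \<Rightarrow> real^'l \<Rightarrow> (real^'l \<Rightarrow> complex^'n^'n) \<Rightarrow> real^'l^'l" where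
  "alpha_z_information \<alpha> z \<theta> \<rho> =
     (\<chi> i j. 1 / \<alpha> * partial_deriv i (partial_deriv j
        (\<lambda>\<epsilon>. alpha_z_divergence \<alpha> z (\<rho> \<theta>) (\<rho> (\<theta> + \<epsilon>)))) 0)"

definition KM_information :: "real^'l \<Rightarrow> (real^'l \<Rightarrow> complex^'n^'n) \<Rightarrow> real^'l^'l" where
  "KM_information \<theta> \<rho> =
     (\<chi> i j. partial_deriv i (partial_deriv j
        (\<lambda>\<epsilon>. relative_entropy (\<rho> \<theta>) (\<rho> (\<theta> + \<epsilon>)))) 0)"

definition RLD_information :: "real^'l \<Rightarrow> (real^'l \<Rightarrow> complex^'n^'n) \<Rightarrow> real^'l^'l" where
  "RLD_information \<theta> \<rho> =
     (\<chi> i j. 1 / 2 * Re (trace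
        ((partial_deriv i \<rho> \<theta> ** partial_deriv j \<rho> \<theta> + partial_deriv j \<rho> \<theta> ** partial_deriv i \<rho> \<theta>)
         ** matrix_inv (\<rho> \<theta>))))"

definition fisher_information :: "real^'l \<Rightarrow> (real^'l \<Rightarrow> 'x::finite \<Rightarrow> real) \<Rightarrow> real^'l^'l" where
  "fisher_information \<theta> p =
     (\<chi> i j. \<Sum>x\<in>UNIV. 1 / p \<theta> x * partial_deriv i (\<lambda>\<eta>. p \<eta> x) \<theta> * partial_deriv j (\<lambda>\<eta>. p \<eta> x) \<theta>)"

end

theory Submission
  imports Defs
begin

text \<open>
  A classical-quantum state is block diagonal, so functional calculus, products, traces and inverses
  act block by block. With weights \<open>p\<close>, \<open>q\<close> and blocks \<open>\<tau> x\<close>, \<open>\<sigma> x\<close> the trace functional of the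
  \<open>\<alpha>\<close>-\<open>z\<close> divergence becomes \<open>\<Sum>x. p x powr \<alpha> * q x powr (1 - \<alpha>) * Q x\<close>, and relative entropy splits
  in the same way; the claims are then second-order product and chain rules at \<open>\<epsilon> = 0\<close>. The mixed
  terms vanish because \<open>Q x = 1\<close> there with zero gradient, and \<open>\<Sum>x. p x = 1\<close> removes the second
  derivatives of \<open>p\<close>.

  What needs work is that \<open>Q x\<close> and the relative entropies are twice differentiable. Near a positive
  definite matrix whose eigenvalues are below \<open>c\<close>, powers and logarithms are given by power
  series in \<open>A / c - 1\<close>, which has operator norm below 1. Such series can be differentiated twice
  term by term; under a trace against a matrix commuting with \<open>A\<close>, the first derivative
  is that of the commutative calculus, which gives the gradient of \<open>Q x\<close>.
\<close>

section \<open>Twice differentiable maps\<close>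

text \<open>The obstacle is noncommutativity: along a curve of matrices the derivative of X^s is not
  s X^(s-1) X'. Moreover \<open>partial_deriv\<close> rests on a choice operator, so no calculus
  rule applies to it before differentiability is known. Second-order differentiability is therefore
  carried as a property of its own, closed under products and composition; the derivative is a point
  of a normed space of bounded linear maps, so that it can be differentiated again. Power series are
  summed in an operator algebra because the norm of \<open>complex^'n^'n\<close> is the Frobenius
  norm, which for A / c - 1 can exceed 1 although every eigenvalue lies inside the unit disc.
  Differentiability is assumed of \<open>\<rho>XA\<close> only; weights and conditional states
  inherit it by compressing to a block, taking its trace and dividing. The gradient of Q x is (1 -
  \<alpha>) times the trace of the derivative of the state, which is zero because the trace is
  constant. The RLD matrix contains first derivatives only, so for it the product rule on each block
  is enough.\<close>

definition twice_diff_at :: "('a::real_normed_vector \<Rightarrow> 'b::real_normed_vector) \<Rightarrow> 'a \<Rightarrow> bool" where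
  "twice_diff_at f x \<longleftrightarrow> (\<exists>f' :: 'a \<Rightarrow> 'a \<Rightarrow>\<^sub>L 'b.
     (\<forall>\<^sub>F y in nhds x. (f has_derivative blinfun_apply (f' y)) (at y)) \<and> f' differentiable (at x))"

lemma twice_diff_atI:
  assumes "\<forall>\<^sub>F y in nhds x. (f has_derivative blinfun_apply (f' y)) (at y)" "f' differentiable (at x)"
  shows "twice_diff_at f x"
  using assms unfolding twice_diff_at_def by blast

lemma twice_diff_atE:
  assumes "twice_diff_at f x"
  obtains f' where "\<forall>\<^sub>F y in nhds x. (f has_derivative blinfun_apply (f' y)) (at y)"
    "f' differentiable (at x)"
  using assms unfolding twice_diff_at_def by blast

lemma has_derivative_eventually_cong:
  assumes "\<forall>\<^sub>F y in nhds x. f y = g y" "(f has_derivative D) (at x)"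
  shows "(g has_derivative D) (at x)"
  by (rule has_derivative_transform_eventually[OF assms(2)])
     (use assms(1) in \<open>auto simp: eventually_at_filter elim: eventually_mono dest: eventually_nhds_x_imp_x\<close>)

lemma twice_diff_at_cong:
  assumes "\<forall>\<^sub>F y in nhds x. f y = g y" "twice_diff_at f x"
  shows "twice_diff_at g x"
proof -
  obtain f' where f': "\<forall>\<^sub>F y in nhds x. (f has_derivative blinfun_apply (f' y)) (at y)"
    "f' differentiable (at x)" using assms(2) by (rule twice_diff_atE)
  \<comment> \<open>Agreement near \<open>x\<close> is an open condition: it also holds near every
    point close to \<open>x\<close>, so the derivatives agree on a whole neighbourhood.\<close>
  have "\<forall>\<^sub>F y in nhds x. \<forall>\<^sub>F z in nhds y. f z = g z"
    using assms(1) by (simp add: eventually_eventually)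
  with f'(1) have "\<forall>\<^sub>F y in nhds x. (g has_derivative blinfun_apply (f' y)) (at y)"
    by eventually_elim (rule has_derivative_eventually_cong)
  then show ?thesis using f'(2) by (rule twice_diff_atI)
qed

lemma twice_diff_at_imp_has_derivative:
  assumes "twice_diff_at f x"
  obtains D where "(f has_derivative D) (at x)"
  using assms by (auto elim!: twice_diff_atE dest!: eventually_nhds_x_imp_x)

lemma twice_diff_at_imp_isCont: "twice_diff_at f x \<Longrightarrow> isCont f x"
  by (metis twice_diff_at_imp_has_derivative has_derivative_continuous)

lemma twice_diff_at_bounded_linear:
  assumes "bounded_linear f"
  shows "twice_diff_at f x"
proof (rule twice_diff_atI)
  show "\<forall>\<^sub>F y in nhds x. (f has_derivative blinfun_apply (Blinfun f)) (at y)"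
    using assms by (simp add: bounded_linear_Blinfun_apply bounded_linear_imp_has_derivative)
qed simp

lemma twice_diff_at_const [simp]: "twice_diff_at (\<lambda>x. c) x"
proof (rule twice_diff_atI)
  show "\<forall>\<^sub>F y in nhds x. ((\<lambda>x. c) has_derivative blinfun_apply 0) (at y)" by (simp add: zero_blinfun.rep_eq)
qed simp

lemma eventually_nhds_compose:
  assumes "isCont f x" "\<forall>\<^sub>F y in nhds (f x). P y"
  shows "\<forall>\<^sub>F y in nhds x. P (f y)"
  using assms(1) assms(2) unfolding isCont_def tendsto_at_iff_tendsto_nhds
  by (rule eventually_compose_filterlim[rotated])

lemma differentiable_bilinear:
  assumes "bounded_bilinear pr" "f differentiable (at x)" "g differentiable (at x)"
  shows "(\<lambda>y. pr (f y) (g y)) differentiable (at x)"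
proof -
  obtain D E where "(f has_derivative D) (at x)" "(g has_derivative E) (at x)"
    using assms(2,3) unfolding differentiable_def by blast
  from bounded_bilinear.FDERIV[OF assms(1) this] show ?thesis by (rule differentiableI)
qed

lemma differentiable_linear:
  assumes "bounded_linear h" "f differentiable (at x)"
  shows "(\<lambda>y. h (f y)) differentiable (at x)"
  using assms differentiable_def bounded_linear.has_derivative by metis

text \<open>The derivative of the composite is \<open>g' (f y) o\<^sub>L f' y\<close>, and
  composition of operators is bilinear, so differentiability of the two factors at \<open>x\<close>
  suffices.\<close>

lemma twice_diff_at_compose:
  assumes f: "twice_diff_at f x" and g: "twice_diff_at g (f x)"
  shows "twice_diff_at (\<lambda>y. g (f y)) x"
proof -
  obtain f' where f': "\<forall>\<^sub>F y in nhds x. (f has_derivative blinfun_apply (f' y)) (at y)"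
    "f' differentiable (at x)" using f by (rule twice_diff_atE)
  obtain g' where g': "\<forall>\<^sub>F y in nhds (f x). (g has_derivative blinfun_apply (g' y)) (at y)"
    "g' differentiable (at (f x))" using g by (rule twice_diff_atE)
  have ev: "\<forall>\<^sub>F y in nhds x. (g has_derivative blinfun_apply (g' (f y))) (at (f y))"
    using twice_diff_at_imp_isCont[OF f] g'(1) by (rule eventually_nhds_compose)
  show ?thesis
  proof (rule twice_diff_atI)
    show "\<forall>\<^sub>F y in nhds x. ((\<lambda>y. g (f y)) has_derivative blinfun_apply (g' (f y) o\<^sub>L f' y)) (at y)"
      using f'(1) ev
    proof eventually_elim
      case (elim y)
      then show ?case
        using diff_chain_at[OF elim] by (simp add: o_def blinfun_compose.rep_eq)
    qed
    have "f differentiable (at x)" using f'(1) eventually_nhds_x_imp_x unfolding differentiable_def by blast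
    then have "(\<lambda>y. g' (f y)) differentiable (at x)"
      using g'(2) differentiable_chain_at by (fastforce simp: o_def)
    then show "(\<lambda>y. g' (f y) o\<^sub>L f' y) differentiable (at x)"
      using f'(2) by (rule differentiable_bilinear[OF bounded_bilinear_blinfun_compose])
  qed
qed

lemma twice_diff_at_bilinear:
  assumes "bounded_bilinear pr" and f: "twice_diff_at f x" and g: "twice_diff_at g x"
  shows "twice_diff_at (\<lambda>y. pr (f y) (g y)) x"
proof -
  interpret bounded_bilinear pr by fact
  obtain f' where f': "\<forall>\<^sub>F y in nhds x. (f has_derivative blinfun_apply (f' y)) (at y)"
    "f' differentiable (at x)" using f by (rule twice_diff_atE)
  obtain g' where g': "\<forall>\<^sub>F y in nhds x. (g has_derivative blinfun_apply (g' y)) (at y)"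
    "g' differentiable (at x)" using g by (rule twice_diff_atE)
  show ?thesis
  proof (rule twice_diff_atI)
    show "\<forall>\<^sub>F y in nhds x. ((\<lambda>y. pr (f y) (g y)) has_derivative
        blinfun_apply ((prod_right (f y) o\<^sub>L g' y) + (prod_left (g y) o\<^sub>L f' y))) (at y)"
      using f'(1) g'(1)
    proof eventually_elim
      case (elim y)
      then show ?case
        using FDERIV[OF elim] by (simp add: o_def blinfun_compose.rep_eq plus_blinfun.rep_eq)
    qed
    have fd: "f differentiable (at x)" and gd: "g differentiable (at x)"
      using f'(1) g'(1) eventually_nhds_x_imp_x unfolding differentiable_def by blast+
    have "(\<lambda>y. prod_right (f y)) differentiable (at x)" "(\<lambda>y. prod_left (g y)) differentiable (at x)"
      using fd gd differentiable_linear[OF bounded_linear_prod_left]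
        differentiable_linear[OF bounded_linear_prod_right] by auto
    then show "(\<lambda>y. (prod_right (f y) o\<^sub>L g' y) + (prod_left (g y) o\<^sub>L f' y)) differentiable (at x)"
      using f'(2) g'(2)
      by (intro differentiable_add differentiable_bilinear[OF bounded_bilinear_blinfun_compose])
  qed
qed

lemma twice_diff_at_linear_compose:
  assumes "bounded_linear h" "twice_diff_at f x"
  shows "twice_diff_at (\<lambda>y. h (f y)) x"
  using twice_diff_at_compose[OF assms(2) twice_diff_at_bounded_linear[OF assms(1)]] .

lemma twice_diff_at_add:
  assumes "twice_diff_at f x" "twice_diff_at g x"
  shows "twice_diff_at (\<lambda>y. f y + g y) x"
proof -
  obtain f' where f': "\<forall>\<^sub>F y in nhds x. (f has_derivative blinfun_apply (f' y)) (at y)"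
    "f' differentiable (at x)" using assms(1) by (rule twice_diff_atE)
  obtain g' where g': "\<forall>\<^sub>F y in nhds x. (g has_derivative blinfun_apply (g' y)) (at y)"
    "g' differentiable (at x)" using assms(2) by (rule twice_diff_atE)
  show ?thesis
  proof (rule twice_diff_atI)
    show "\<forall>\<^sub>F y in nhds x. ((\<lambda>y. f y + g y) has_derivative blinfun_apply (f' y + g' y)) (at y)"
      using f'(1) g'(1) by eventually_elim (auto simp: plus_blinfun.rep_eq intro: has_derivative_add)
  qed (use f'(2) g'(2) in simp)
qed

lemma twice_diff_at_cmult: "twice_diff_at f x \<Longrightarrow> twice_diff_at (\<lambda>y. c * f y :: real) x"
  by (rule twice_diff_at_linear_compose[OF bounded_linear_mult_right])

lemma twice_diff_at_real:
  fixes G :: "real \<Rightarrow> real"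
  assumes "\<forall>\<^sub>F v in nhds u. (G has_field_derivative G' v) (at v)" "(G' has_field_derivative G'') (at u)"
  shows "twice_diff_at G u"
proof (rule twice_diff_atI)
  show "\<forall>\<^sub>F v in nhds u. (G has_derivative blinfun_apply (blinfun_mult_right (G' v))) (at v)"
    using assms(1) by eventually_elim (simp add: has_field_derivative_def)
  show "(\<lambda>v. blinfun_mult_right (G' v)) differentiable (at u)"
    by (rule differentiable_linear[OF bounded_linear_blinfun_mult_right])
      (use assms(2) in \<open>auto simp: has_field_derivative_def intro: differentiableI\<close>)
qed

text \<open>The divergences are differentiated in an increment at 0, whereas the families are known
  to be smooth at the parameter itself.\<close>

lemma twice_diff_at_shift:
  assumes "twice_diff_at f (x + y)"
  shows "twice_diff_at (\<lambda>e. f (x + e)) y"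
proof -
  have "twice_diff_at (\<lambda>e. x + e) y"
    by (intro twice_diff_at_add twice_diff_at_const twice_diff_at_bounded_linear bounded_linear_ident)
  from twice_diff_at_compose[OF this, of f] assms show ?thesis by simp
qed

lemma twice_diff_at_powr:
  fixes u :: real assumes "u > 0" shows "twice_diff_at (\<lambda>v. v powr s) u"
proof (rule twice_diff_at_real)
  have "\<forall>\<^sub>F v in nhds u. v > 0" using assms by (simp add: eventually_nhds_in_open[of "{0<..}", simplified])
  then show "\<forall>\<^sub>F v in nhds u. ((\<lambda>v. v powr s) has_field_derivative s * v powr (s - 1)) (at v)"
    by eventually_elim (rule has_real_derivative_powr)
  show "((\<lambda>v. s * v powr (s - 1)) has_field_derivative s * ((s - 1) * u powr (s - 1 - 1))) (at u)"
    by (intro DERIV_cmult has_real_derivative_powr assms)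
qed

lemma twice_diff_at_ln:
  fixes u :: real assumes "u > 0" shows "twice_diff_at ln u"
proof (rule twice_diff_at_real)
  have "\<forall>\<^sub>F v in nhds u. v > 0" using assms by (simp add: eventually_nhds_in_open[of "{0<..}", simplified])
  then show "\<forall>\<^sub>F v in nhds u. (ln has_field_derivative inverse v) (at v)"
    by eventually_elim (rule DERIV_ln)
  show "(inverse has_field_derivative - (inverse u ^ Suc (Suc 0))) (at u)"
    using assms by (intro DERIV_inverse) auto
qed

lemma twice_differentiable_on_imp_at:
  assumes "twice_differentiable_on f S" "open S" "x \<in> S"
  shows "twice_diff_at f x"
proof -
  obtain f' where f': "\<forall>x\<in>S. (f has_derivative blinfun_apply (f' x)) (at x within S)" "f' differentiable_on S"
    using assms(1) unfolding twice_differentiable_on_def by blast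
  show ?thesis
  proof (rule twice_diff_atI)
    have "\<forall>\<^sub>F y in nhds x. y \<in> S" using assms by (simp add: eventually_nhds_in_open)
    then show "\<forall>\<^sub>F y in nhds x. (f has_derivative blinfun_apply (f' y)) (at y)"
      by eventually_elim (use f'(1) assms(2) in \<open>metis at_within_open\<close>)
    show "f' differentiable (at x)"
      using f'(2) assms by (metis at_within_open differentiable_on_def)
  qed
qed

section \<open>Power series of bounded operators\<close>

primrec blinfun_pow :: "('a::real_normed_vector \<Rightarrow>\<^sub>L 'a) \<Rightarrow> nat \<Rightarrow> 'a \<Rightarrow>\<^sub>L 'a" where
  "blinfun_pow x 0 = id_blinfun"
| "blinfun_pow x (Suc k) = x o\<^sub>L blinfun_pow x k"

abbreviation "precomp \<equiv> bounded_bilinear.prod_left (o\<^sub>L)"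
abbreviation "postcomp \<equiv> bounded_bilinear.prod_right (o\<^sub>L)"

lemma precomp_apply [simp]: "blinfun_apply (precomp x) y = y o\<^sub>L x"
  by (simp add: bounded_bilinear.prod_left.rep_eq[OF bounded_bilinear_blinfun_compose])

lemma postcomp_apply [simp]: "blinfun_apply (postcomp x) y = x o\<^sub>L y"
  by (simp add: bounded_bilinear.prod_right.rep_eq[OF bounded_bilinear_blinfun_compose])

lemma norm_precomp_le: "norm (precomp x) \<le> norm x"
  by (rule norm_blinfun_bound) (simp_all only: precomp_apply norm_ge_zero norm_blinfun_compose mult.commute[of "norm x"])

lemma norm_postcomp_le: "norm (postcomp x) \<le> norm x"
  by (rule norm_blinfun_bound) (simp_all only: postcomp_apply norm_ge_zero norm_blinfun_compose)

lemma norm_compose_le: "norm x \<le> a \<Longrightarrow> norm y \<le> b \<Longrightarrow> norm (x o\<^sub>L y) \<le> a * b"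
  by (meson norm_blinfun_compose mult_mono norm_ge_zero order_trans)

text \<open>Unrolled, this map sends h to the sum of x^i h x^j over i + j = k - 1.\<close>

primrec blinfun_pow_deriv :: "('a::real_normed_vector \<Rightarrow>\<^sub>L 'a) \<Rightarrow> nat \<Rightarrow> ('a \<Rightarrow>\<^sub>L 'a) \<Rightarrow>\<^sub>L ('a \<Rightarrow>\<^sub>L 'a)" where
  "blinfun_pow_deriv x 0 = 0"
| "blinfun_pow_deriv x (Suc k) = precomp (blinfun_pow x k) + (postcomp x o\<^sub>L blinfun_pow_deriv x k)"

text \<open>The Leibniz rule applied to the recursion of \<open>blinfun_pow_deriv\<close>: the three
  terms differentiate the power \<open>blinfun_pow x k\<close>, the left factor \<open>x\<close> and
  \<open>blinfun_pow_deriv x k\<close>. Here \<open>precomp\<close> and \<open>postcomp\<close> act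
  on two levels, on operators and on maps between operators.\<close>

primrec blinfun_pow_deriv2 :: "('a::real_normed_vector \<Rightarrow>\<^sub>L 'a) \<Rightarrow> nat \<Rightarrow>
    ('a \<Rightarrow>\<^sub>L 'a) \<Rightarrow>\<^sub>L ('a \<Rightarrow>\<^sub>L 'a) \<Rightarrow>\<^sub>L ('a \<Rightarrow>\<^sub>L 'a)" where
  "blinfun_pow_deriv2 x 0 = 0"
| "blinfun_pow_deriv2 x (Suc k) = (Blinfun precomp o\<^sub>L blinfun_pow_deriv x k)
     + (precomp (blinfun_pow_deriv x k) o\<^sub>L Blinfun postcomp) + (postcomp (postcomp x) o\<^sub>L blinfun_pow_deriv2 x k)"

lemmas bounded_linear_precomp = bounded_bilinear.bounded_linear_prod_left[OF bounded_bilinear_blinfun_compose]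
lemmas bounded_linear_postcomp = bounded_bilinear.bounded_linear_prod_right[OF bounded_bilinear_blinfun_compose]

lemma norm_Blinfun_precomp: "norm (Blinfun precomp) \<le> 1"
  by (rule norm_blinfun_bound) (auto simp: bounded_linear_Blinfun_apply[OF bounded_linear_precomp] norm_precomp_le)

lemma norm_Blinfun_postcomp: "norm (Blinfun postcomp) \<le> 1"
  by (rule norm_blinfun_bound) (auto simp: bounded_linear_Blinfun_apply[OF bounded_linear_postcomp] norm_postcomp_le)

lemma has_derivative_blinfun_pow:
  "((\<lambda>x. blinfun_pow x k) has_derivative blinfun_apply (blinfun_pow_deriv x k)) (at x)"
proof (induction k)
  case 0
  then show ?case by (simp add: zero_blinfun.rep_eq)
next
  case (Suc k)
  show ?case
    using bounded_bilinear.FDERIV[OF bounded_bilinear_blinfun_compose has_derivative_ident Suc]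
    by (simp add: plus_blinfun.rep_eq blinfun_compose.rep_eq o_def add.commute)
qed

lemma has_derivative_blinfun_pow_deriv:
  "((\<lambda>x. blinfun_pow_deriv x k) has_derivative blinfun_apply (blinfun_pow_deriv2 x k)) (at x)"
proof (induction k)
  case 0
  then show ?case by (simp add: zero_blinfun.rep_eq)
next
  case (Suc k)
  have 1: "((\<lambda>x. precomp (blinfun_pow x k)) has_derivative (\<lambda>h. precomp (blinfun_pow_deriv x k h))) (at x)"
    by (rule bounded_linear.has_derivative[OF bounded_linear_precomp has_derivative_blinfun_pow])
  have 2: "(postcomp has_derivative postcomp) (at x)"
    by (rule bounded_linear_imp_has_derivative[OF bounded_linear_postcomp])
  show ?case
    using has_derivative_add[OF 1 bounded_bilinear.FDERIV[OF bounded_bilinear_blinfun_compose 2 Suc]]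
    by (simp add: plus_blinfun.rep_eq blinfun_compose.rep_eq o_def add_ac
        bounded_linear_Blinfun_apply[OF bounded_linear_precomp] bounded_linear_Blinfun_apply[OF bounded_linear_postcomp])
qed

lemma norm_blinfun_pow: "norm x \<le> r \<Longrightarrow> norm (blinfun_pow x k) \<le> r ^ k"
  by (induction k) (auto intro: norm_compose_le norm_blinfun_id_le)

text \<open>Multiplying by \<open>r\<close> and \<open>r\<^sup>2\<close> avoids the truncated exponents \<open>k - 1\<close> and \<open>k - 2\<close>.\<close>

lemma norm_blinfun_pow_deriv:
  assumes "norm x \<le> r"
  shows "norm (blinfun_pow_deriv x k) * r \<le> real k * r ^ k"
proof (induction k)
  case (Suc k)
  have r: "r \<ge> 0" using assms norm_ge_zero order_trans by blast
  have "norm (blinfun_pow_deriv x (Suc k)) \<le> norm (blinfun_pow x k) + norm x * norm (blinfun_pow_deriv x k)"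
    unfolding blinfun_pow_deriv.simps
    by (intro norm_triangle_mono norm_precomp_le norm_compose_le[OF norm_postcomp_le order_refl])
  also have "\<dots> \<le> r ^ k + r * norm (blinfun_pow_deriv x k)"
    using assms by (intro add_mono mult_right_mono norm_blinfun_pow) auto
  finally have "norm (blinfun_pow_deriv x (Suc k)) * r \<le> r ^ k * r + r * (norm (blinfun_pow_deriv x k) * r)"
    using r by (auto simp: algebra_simps dest: mult_right_mono)
  also have "\<dots> \<le> r ^ k * r + r * (real k * r ^ k)"
    using Suc r by (intro add_left_mono mult_left_mono) auto
  finally show ?case by (simp add: algebra_simps)
qed simp

lemma norm_blinfun_pow_deriv2:
  assumes "norm x \<le> r"
  shows "norm (blinfun_pow_deriv2 x k) * r\<^sup>2 \<le> (real k)\<^sup>2 * r ^ k"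
proof (induction k)
  case (Suc k)
  have r: "r \<ge> 0" using assms norm_ge_zero order_trans by blast
  let ?n = "norm (blinfun_pow_deriv x k)" and ?m = "norm (blinfun_pow_deriv2 x k)"
  have "norm (Blinfun precomp o\<^sub>L blinfun_pow_deriv x k) \<le> 1 * ?n"
    using norm_Blinfun_precomp by (intro norm_compose_le) auto
  moreover have "norm (precomp (blinfun_pow_deriv x k) o\<^sub>L Blinfun postcomp) \<le> ?n * 1"
    using norm_Blinfun_postcomp norm_precomp_le by (intro norm_compose_le) auto
  moreover have "norm (postcomp (postcomp x) o\<^sub>L blinfun_pow_deriv2 x k) \<le> r * ?m"
    using order_trans[OF norm_postcomp_le order_trans[OF norm_postcomp_le assms]] by (intro norm_compose_le) auto
  ultimately have "norm (blinfun_pow_deriv2 x (Suc k)) \<le> 1 * ?n + ?n * 1 + r * ?m"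
    unfolding blinfun_pow_deriv2.simps by (intro norm_triangle_mono)
  then have "norm (blinfun_pow_deriv2 x (Suc k)) * r\<^sup>2 \<le> (1 * ?n + ?n * 1 + r * ?m) * r\<^sup>2"
    by (rule mult_right_mono) simp
  also have "\<dots> = 2 * r * (?n * r) + r * (?m * r\<^sup>2)" by (simp add: power2_eq_square algebra_simps)
  also have "\<dots> \<le> 2 * r * (real k * r ^ k) + r * ((real k)\<^sup>2 * r ^ k)"
    using Suc r norm_blinfun_pow_deriv[OF assms] by (intro add_mono mult_left_mono) auto
  also have "\<dots> \<le> (real (Suc k))\<^sup>2 * r ^ Suc k"
    using r by (simp add: power2_eq_square algebra_simps)
  finally show ?case .
qed simp

text \<open>Bounds in operator norm let the Weierstrass test deliver the estimate uniform in the
  direction \<open>h\<close> that termwise differentiation requires; the series itself then has to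
  converge at one point only.\<close>

lemma has_derivative_series_blinfun:
  fixes f :: "nat \<Rightarrow> 'a::real_normed_vector \<Rightarrow> 'b::banach" and F :: "nat \<Rightarrow> 'a \<Rightarrow> 'a \<Rightarrow>\<^sub>L 'b"
  assumes S: "convex S" "open S" "x0 \<in> S"
    and f: "\<And>n x. x \<in> S \<Longrightarrow> (f n has_derivative blinfun_apply (F n x)) (at x)"
    and M: "\<And>n x. x \<in> S \<Longrightarrow> norm (F n x) \<le> M n" "summable M"
    and s: "summable (\<lambda>n. f n x0)" and x: "x \<in> S"
  shows "(\<lambda>n. f n x) sums (\<Sum>n. f n x)"
    and "((\<lambda>x. \<Sum>n. f n x) has_derivative blinfun_apply (\<Sum>n. F n x)) (at x)"
proof -
  have ul: "uniform_limit S (\<lambda>n x. \<Sum>i<n. F i x) (\<lambda>x. \<Sum>n. F n x) sequentially"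
    using M by (rule Weierstrass_m_test)
  have "\<exists>g. \<forall>x\<in>S. (\<lambda>n. f n x) sums (g x) \<and> (g has_derivative blinfun_apply (\<Sum>n. F n x)) (at x within S)"
  proof (rule has_derivative_series[where f=f and f'="\<lambda>n x. blinfun_apply (F n x)"
        and g'="\<lambda>x. blinfun_apply (\<Sum>n. F n x)" and S=S, OF S(1) _ _ S(3) summable_sums[OF s]])
    fix e :: real assume "e > 0"
    with ul have "\<forall>\<^sub>F n in sequentially. \<forall>x\<in>S. dist (\<Sum>i<n. F i x) (\<Sum>n. F n x) < e"
      by (rule uniform_limitD)
    then show "\<forall>\<^sub>F n in sequentially. \<forall>x\<in>S. \<forall>h. norm ((\<Sum>i<n. blinfun_apply (F i x) h)
        - blinfun_apply (\<Sum>n. F n x) h) \<le> e * norm h"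
    proof eventually_elim
      case (elim n)
      show ?case
      proof (intro ballI allI)
        fix x h assume "x \<in> S"
        have "norm ((\<Sum>i<n. blinfun_apply (F i x) h) - blinfun_apply (\<Sum>n. F n x) h)
          = norm (blinfun_apply ((\<Sum>i<n. F i x) - (\<Sum>n. F n x)) h)"
          by (simp add: blinfun.diff_left blinfun.sum_left)
        also have "\<dots> \<le> norm ((\<Sum>i<n. F i x) - (\<Sum>n. F n x)) * norm h" by (rule norm_blinfun)
        also have "\<dots> \<le> e * norm h"
          using elim \<open>x \<in> S\<close> by (intro mult_right_mono) (auto simp: dist_norm less_imp_le)
        finally show "norm ((\<Sum>i<n. blinfun_apply (F i x) h) - blinfun_apply (\<Sum>n. F n x) h) \<le> e * norm h" .
      qed
    qed
  qed (rule has_derivative_at_withinI[OF f])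
  then obtain g where g: "\<And>x. x \<in> S \<Longrightarrow> (\<lambda>n. f n x) sums (g x)"
    "\<And>x. x \<in> S \<Longrightarrow> (g has_derivative blinfun_apply (\<Sum>n. F n x)) (at x within S)" by blast
  show "(\<lambda>n. f n x) sums (\<Sum>n. f n x)" using summable_sums[OF sums_summable[OF g(1)[OF x]]] .
  have "(g has_derivative blinfun_apply (\<Sum>n. F n x)) (at x)" using g(2)[OF x] unfolding at_within_open[OF x S(2)] .
  moreover have "\<forall>\<^sub>F y in nhds x. g y = (\<Sum>n. f n y)"
    using eventually_nhds_in_open[OF S(2) x] by eventually_elim (rule sums_unique[OF g(1)])
  ultimately show "((\<lambda>x. \<Sum>n. f n x) has_derivative blinfun_apply (\<Sum>n. F n x)) (at x)"
    by (rule has_derivative_eventually_cong[rotated])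
qed

text \<open>Differentiating the geometric series twice produces the coefficients (k + 1)(k + 2),
  which dominate k^2.\<close>

lemma summable_square_geometric:
  fixes q :: real
  assumes "0 \<le> q" "q < 1"
  shows "summable (\<lambda>k. (real k)\<^sup>2 * q ^ k)"
proof -
  have "summable (\<lambda>k. (1::real) * u ^ k)" if "norm u < 1" for u :: real
    using that by (simp add: summable_geometric)
  then have "summable (\<lambda>k. diffs (\<lambda>_. 1::real) k * u ^ k)" if "norm u < 1" for u :: real
    using that by (intro termdiff_converges[where K=1]) auto
  then have "summable (\<lambda>k. diffs (diffs (\<lambda>_. 1::real)) k * q ^ k)"
    using assms by (intro termdiff_converges[where K=1]) auto
  then show ?thesis
  proof (rule summable_comparison_test'[where N=0])
    fix k :: nat
    have "(real k)\<^sup>2 \<le> diffs (diffs (\<lambda>_. 1::real)) k"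
      by (simp add: diffs_def power2_eq_square algebra_simps)
    then show "norm ((real k)\<^sup>2 * q ^ k) \<le> diffs (diffs (\<lambda>_. 1::real)) k * q ^ k"
      using assms by (simp add: mult_right_mono)
  qed
qed

text \<open>At a radius \<open>s\<close> strictly between \<open>r\<close> and 1 the terms of the
  series are bounded, and the geometric ratio r / s then absorbs the factor k^2.\<close>

lemma summable_power_weights:
  fixes a :: "nat \<Rightarrow> real"
  assumes a: "\<And>u. \<bar>u\<bar> < 1 \<Longrightarrow> summable (\<lambda>k. a k * u ^ k)" and r: "0 \<le> r" "r < 1"
  shows "summable (\<lambda>k. \<bar>a k\<bar> * ((real k)\<^sup>2 * r ^ k))"
proof -
  define s where "s = (1 + r) / 2"
  have s: "r < s" "s < 1" "0 < s" using r by (auto simp: s_def)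
  have "summable (\<lambda>k. a k * s ^ k)" using a s by simp
  then have "Bseq (\<lambda>k. a k * s ^ k)"
    by (meson convergentI convergent_imp_Bseq summable_LIMSEQ_zero)
  then obtain B where B: "\<And>k. \<bar>a k * s ^ k\<bar> \<le> B"
    using BseqE by (metis real_norm_def)
  define q where "q = r / s"
  have q: "0 \<le> q" "q < 1" using r s by (auto simp: q_def)
  have "summable (\<lambda>k. (real k)\<^sup>2 * q ^ k)"
    using q by (rule summable_square_geometric)
  then have "summable (\<lambda>k. B * ((real k)\<^sup>2 * q ^ k))" by (rule summable_mult)
  then show ?thesis
  proof (rule summable_comparison_test'[where N=0])
    fix k
    have "r ^ k = s ^ k * q ^ k" using s by (simp add: q_def power_divide)
    then have "\<bar>a k\<bar> * ((real k)\<^sup>2 * r ^ k) = \<bar>a k * s ^ k\<bar> * ((real k)\<^sup>2 * q ^ k)"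
      using s by (simp add: abs_mult)
    also have "\<dots> \<le> B * ((real k)\<^sup>2 * q ^ k)" using B q by (intro mult_right_mono) auto
    finally show "norm (\<bar>a k\<bar> * ((real k)\<^sup>2 * r ^ k)) \<le> B * ((real k)\<^sup>2 * q ^ k)"
      using r by simp
  qed
qed

definition blinfun_powser :: "(nat \<Rightarrow> real) \<Rightarrow> ('a::banach \<Rightarrow>\<^sub>L 'a) \<Rightarrow> 'a \<Rightarrow>\<^sub>L 'a" where
  "blinfun_powser a x = (\<Sum>k. a k *\<^sub>R blinfun_pow x k)"

text \<open>On an open ball around 0 whose radius lies strictly between \<open>norm x\<close> and 1
  the bounds for the derivatives of the powers are uniform. The theorem on series is used twice, for
  the powers and for their derivatives.\<close>

lemma blinfun_powser:
  fixes a :: "nat \<Rightarrow> real" and x :: "'a::banach \<Rightarrow>\<^sub>L 'a"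
  assumes a: "\<And>u. \<bar>u\<bar> < 1 \<Longrightarrow> summable (\<lambda>k. a k * u ^ k)" and x: "norm x < 1"
  shows blinfun_powser_sums: "(\<lambda>k. a k *\<^sub>R blinfun_pow x k) sums blinfun_powser a x"
    and has_derivative_blinfun_powser:
      "(blinfun_powser a has_derivative blinfun_apply (\<Sum>k. a k *\<^sub>R blinfun_pow_deriv x k)) (at x)"
    and summable_blinfun_pow_deriv: "summable (\<lambda>k. a k *\<^sub>R blinfun_pow_deriv x k)"
    and twice_diff_at_blinfun_powser: "twice_diff_at (blinfun_powser a) x"
proof -
  obtain r where r: "norm x < r" "r < 1" using x dense by blast
  then have r0: "0 < r" by (meson norm_ge_zero order_le_less_trans)
  define S where "S = ball (0 :: 'a \<Rightarrow>\<^sub>L 'a) r"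
  have S: "convex S" "open S" "0 \<in> S" "x \<in> S" using r r0 by (auto simp: S_def)
  have Sr: "norm y \<le> r" if "y \<in> S" for y using that by (simp add: S_def)
  \<comment> \<open>One majorant serves both series: k \<le> k^2 covers the first derivative, and
    the divisors r and r^2 below undo the factors in the norm bounds.\<close>
  have W: "summable (\<lambda>k. \<bar>a k\<bar> * ((real k)\<^sup>2 * r ^ k))"
    using a r r0 by (intro summable_power_weights) auto
  have W1: "summable (\<lambda>k. (\<bar>a k\<bar> * ((real k)\<^sup>2 * r ^ k)) / r)"
    and W2: "summable (\<lambda>k. (\<bar>a k\<bar> * ((real k)\<^sup>2 * r ^ k)) / r\<^sup>2)"
    by (rule summable_divide[OF W])+
  have d: "((\<lambda>x. a k *\<^sub>R blinfun_pow x k) has_derivative blinfun_apply (a k *\<^sub>R blinfun_pow_deriv y k)) (at y)" for k and y :: "'a \<Rightarrow>\<^sub>L 'a"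
    using has_derivative_scaleR_right[OF has_derivative_blinfun_pow] by (simp add: scaleR_blinfun.rep_eq)
  have d2: "((\<lambda>x. a k *\<^sub>R blinfun_pow_deriv x k) has_derivative blinfun_apply (a k *\<^sub>R blinfun_pow_deriv2 y k)) (at y)" for k and y :: "'a \<Rightarrow>\<^sub>L 'a"
    using has_derivative_scaleR_right[OF has_derivative_blinfun_pow_deriv] by (simp add: scaleR_blinfun.rep_eq)
  have n1: "norm (a k *\<^sub>R blinfun_pow_deriv y k) \<le> (\<bar>a k\<bar> * ((real k)\<^sup>2 * r ^ k)) / r" if "y \<in> S" for k y
  proof -
    have "norm (blinfun_pow_deriv y k) * r \<le> real k * r ^ k" by (rule norm_blinfun_pow_deriv[OF Sr[OF that]])
    also have "\<dots> \<le> (real k)\<^sup>2 * r ^ k"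
      using r0 by (cases k) (auto simp: power2_eq_square intro!: mult_right_mono)
    finally have "\<bar>a k\<bar> * (norm (blinfun_pow_deriv y k) * r) \<le> \<bar>a k\<bar> * ((real k)\<^sup>2 * r ^ k)"
      by (rule mult_left_mono) simp
    then show ?thesis using r0 by (simp add: pos_le_divide_eq mult.assoc)
  qed
  have n2: "norm (a k *\<^sub>R blinfun_pow_deriv2 y k) \<le> (\<bar>a k\<bar> * ((real k)\<^sup>2 * r ^ k)) / r\<^sup>2" if "y \<in> S" for k y
  proof -
    have "\<bar>a k\<bar> * (norm (blinfun_pow_deriv2 y k) * r\<^sup>2) \<le> \<bar>a k\<bar> * ((real k)\<^sup>2 * r ^ k)"
      by (rule mult_left_mono[OF norm_blinfun_pow_deriv2[OF Sr[OF that]]]) simp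
    then show ?thesis using r0 by (simp add: pos_le_divide_eq mult.assoc)
  qed
  \<comment> \<open>The base point is 0, where only the constant term of the series
    survives.\<close>
  have "blinfun_pow (0 :: 'a \<Rightarrow>\<^sub>L 'a) k = 0" if "k \<noteq> 0" for k using that by (cases k) auto
  then have s0: "summable (\<lambda>k. a k *\<^sub>R blinfun_pow (0 :: 'a \<Rightarrow>\<^sub>L 'a) k)"
    by (intro summable_finite[of "{0}"]) auto
  have s1: "summable (\<lambda>k. a k *\<^sub>R blinfun_pow_deriv (0 :: 'a \<Rightarrow>\<^sub>L 'a) k)"
    using n1[OF S(3)] by (intro summable_comparison_test'[OF W1, where N=0]) auto
  show sm: "(\<lambda>k. a k *\<^sub>R blinfun_pow x k) sums blinfun_powser a x"
    unfolding blinfun_powser_def using has_derivative_series_blinfun(1)[OF S(1-3) d n1 W1 s0 S(4)] .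
  have dr: "(blinfun_powser a has_derivative blinfun_apply (\<Sum>k. a k *\<^sub>R blinfun_pow_deriv y k)) (at y)" if "y \<in> S" for y
    unfolding blinfun_powser_def using has_derivative_series_blinfun(2)[OF S(1-3) d n1 W1 s0 that] .
  then show "(blinfun_powser a has_derivative blinfun_apply (\<Sum>k. a k *\<^sub>R blinfun_pow_deriv x k)) (at x)" using S by blast
  show "summable (\<lambda>k. a k *\<^sub>R blinfun_pow_deriv x k)"
    using has_derivative_series_blinfun(1)[OF S(1-3) d2 n2 W2 s1 S(4)] by (rule sums_summable)
  show "twice_diff_at (blinfun_powser a) x"
  proof (rule twice_diff_atI)
    show "\<forall>\<^sub>F y in nhds x. (blinfun_powser a has_derivative blinfun_apply (\<Sum>k. a k *\<^sub>R blinfun_pow_deriv y k)) (at y)"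
      using eventually_nhds_in_open[OF S(2,4)] by eventually_elim (rule dr)
    show "(\<lambda>y. \<Sum>k. a k *\<^sub>R blinfun_pow_deriv y k) differentiable (at x)"
      using has_derivative_series_blinfun(2)[OF S(1-3) d2 n2 W2 s1 S(4)] by (rule differentiableI)
  qed
qed

section \<open>Spectral theorem and functional calculus\<close>

lemma dagger_nth [simp]: "dagger A $ i $ j = cnj (A $ j $ i)"
  by (simp add: dagger_def transpose_def map_matrix_def)

lemma dagger_dagger [simp]: "dagger (dagger A) = A"
  by (simp add: vec_eq_iff)

lemma dagger_mult: "dagger (A ** B) = dagger B ** dagger A"
  by (simp add: vec_eq_iff matrix_matrix_mult_def mult.commute)

lemma dagger_sum: "dagger (\<Sum>x\<in>A. F x) = (\<Sum>x\<in>A. dagger (F x))"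
  by (simp add: vec_eq_iff)

lemma Re_cinner: "Re (cinner v w) = inner v w"
  by (simp add: cinner_def inner_vec_def inner_complex_def)

lemma cinner_matrix: "cinner v (A *v w) = cinner (dagger A *v v) w"
proof -
  have "cinner v (A *v w) = (\<Sum>i\<in>UNIV. \<Sum>j\<in>UNIV. cnj (v $ i) * (A $ i $ j * w $ j))"
    by (simp add: cinner_def matrix_vector_mult_def sum_distrib_left)
  also have "\<dots> = (\<Sum>j\<in>UNIV. \<Sum>i\<in>UNIV. cnj (v $ i) * (A $ i $ j * w $ j))"
    by (rule sum.swap)
  also have "\<dots> = cinner (dagger A *v v) w"
    by (simp add: cinner_def matrix_vector_mult_def sum_distrib_right sum_distrib_left mult_ac)
  finally show ?thesis .
qed

lemma unitary_cancel:
  assumes "unitary U"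
  shows "dagger U ** U = mat 1" "U ** dagger U = mat 1"
    "dagger U ** (U ** X) = X" "U ** (dagger U ** X) = X"
  using assms by (simp_all add: unitary_def matrix_mul_assoc)

lemma unitaryI: "dagger U ** U = mat 1 \<Longrightarrow> unitary (U :: complex^'n^'n)"
  by (simp add: unitary_def matrix_left_right_inverse)

lemma diag_mat_mult_nth [simp]: "(diag_mat d ** M) $ i $ j = complex_of_real (d i) * M $ i $ j"
  by (simp add: matrix_matrix_mult_def diag_mat_def if_distrib if_distribR cong: if_cong)

lemma mult_diag_mat_nth [simp]: "(M ** diag_mat d) $ i $ j = M $ i $ j * complex_of_real (d j)"
  by (simp add: matrix_matrix_mult_def diag_mat_def if_distrib if_distribR cong: if_cong)

lemma diag_mat_mult: "diag_mat d ** diag_mat e = diag_mat (\<lambda>i. d i * e i)"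
  by (simp add: vec_eq_iff, simp add: diag_mat_def)

lemma dagger_diag_mat [simp]: "dagger (diag_mat d) = diag_mat d"
  by (simp add: vec_eq_iff diag_mat_def)

text \<open>Working over the reals, with the real inner product that is the real part of
  \<open>cinner\<close>, makes the eigenvalue real from the outset. The invariant subspace
  \<open>W\<close> will be the orthogonal complement of the eigenvectors already found.\<close>

lemma selfadjoint_eigenvector:
  fixes T :: "'e::euclidean_space \<Rightarrow> 'e"
  assumes T: "linear T" and sa: "\<And>x y. inner (T x) y = inner x (T y)"
    and W: "subspace W" "\<And>x. x \<in> W \<Longrightarrow> T x \<in> W" "v \<in> W" "v \<noteq> 0"
  obtains d u where "u \<in> W" "norm u = 1" "T u = d *\<^sub>R u"
proof -
  define S where "S = W \<inter> sphere 0 1"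
  have "compact S" unfolding S_def
    using closed_subspace[OF W(1)] by (simp add: closed_Int_compact)
  moreover have "(1 / norm v) *\<^sub>R v \<in> S"
    using W by (auto simp: S_def intro: subspace_scale)
  then have "S \<noteq> {}" by blast
  moreover have "continuous_on S (\<lambda>x. inner x (T x))"
    using T by (intro continuous_intros linear_continuous_on linear_conv_bounded_linear[THEN iffD1])
  ultimately obtain u where u: "u \<in> S" "\<And>x. x \<in> S \<Longrightarrow> inner x (T x) \<le> inner u (T u)"
    using continuous_attains_sup by metis
  txt \<open>Maximality of the Rayleigh quotient at \<open>u\<close> makes the residual \<open>w\<close> below vanish.\<close>
  define \<mu> where "\<mu> = inner u (T u)"
  have nu: "inner u u = 1" using u(1) by (simp add: S_def dot_square_norm)
  have bound: "inner x (T x) \<le> \<mu> * inner x x" if "x \<in> W" for x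
  proof (cases "x = 0")
    case False
    let ?y = "(1 / norm x) *\<^sub>R x"
    have "?y \<in> S" using that W(1) False by (auto simp: S_def intro: subspace_scale)
    from u(2)[OF this] have "inner x (T x) / (norm x)\<^sup>2 \<le> \<mu>"
      by (simp add: \<mu>_def linear_scale[OF T] power2_eq_square)
    then show ?thesis using False by (simp add: pos_divide_le_eq dot_square_norm)
  qed (simp add: linear_0[OF T])
  define w where "w = T u - \<mu> *\<^sub>R u"
  have "u \<in> W" using u by (simp add: S_def)
  then have wW: "w \<in> W" unfolding w_def using W by (intro subspace_diff subspace_scale) auto
  have wTu: "inner w (T u) - \<mu> * inner u w = inner w w"
    by (simp add: w_def inner_diff_left inner_diff_right inner_commute algebra_simps)
  define c where "c = \<mu> * inner w w - inner w (T w)"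
  \<comment> \<open>The Rayleigh bound is tested at u + t w. The constant terms cancel, and a term
    linear in t remains below a quadratic one for every real t.\<close>
  have ineq: "2 * t * inner w w \<le> t\<^sup>2 * c" for t
  proof -
    have "u + t *\<^sub>R w \<in> W" using \<open>u \<in> W\<close> wW W(1) by (intro subspace_add subspace_scale)
    from bound[OF this] have "\<mu> + 2 * t * inner w (T u) + t\<^sup>2 * inner w (T w) \<le>
        \<mu> * (1 + 2 * t * inner u w + t\<^sup>2 * inner w w)"
      using nu sa[of u w]
      by (simp add: linear_add[OF T] linear_scale[OF T] inner_add_left inner_add_right \<mu>_def[symmetric]
          inner_commute power2_eq_square algebra_simps)
    then show ?thesis unfolding c_def wTu[symmetric] by (simp add: algebra_simps)
  qed
  have "inner w w = 0"
  proof (rule ccontr)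
    assume "inner w w \<noteq> 0"
    then have pos: "inner w w > 0" using inner_ge_zero[of w] by linarith
    \<comment> \<open>Chosen so that t |c| \<le> inner w w, which contradicts 2 inner w w \<le> t c;
      the summand 1 keeps the denominator positive.\<close>
    define t where "t = inner w w / (\<bar>c\<bar> + 1)"
    have t: "t > 0" using pos by (simp add: t_def)
    have "2 * inner w w \<le> t * c"
      using ineq[of t] t by (simp add: power2_eq_square)
    also have "\<dots> \<le> t * \<bar>c\<bar>" using t by (intro mult_left_mono) auto
    also have "\<dots> \<le> inner w w"
      using pos by (simp add: t_def divide_le_eq)
    finally show False using pos by simp
  qed
  then have "T u = \<mu> *\<^sub>R u" by (simp add: w_def)
  with u(1) show thesis by (intro that[of u \<mu>]) (auto simp: S_def)
qed

lemma cinner_add_right: "cinner v (w + w') = cinner v w + cinner v w'"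
  by (simp add: cinner_def sum.distrib algebra_simps)

lemma cinner_scaleR_right: "cinner v (r *\<^sub>R w) = r *\<^sub>R cinner v w"
  by (simp add: cinner_def scaleR_sum_right)

lemma cinner_scaleR_left: "cinner (r *\<^sub>R v) w = r *\<^sub>R cinner v w"
  by (simp add: cinner_def scaleR_sum_right)

lemma cinner_commute: "cinner w v = cnj (cinner v w)"
  by (simp add: cinner_def mult.commute)

lemma cinner_self: "cinner v v = complex_of_real ((norm v)\<^sup>2)"
proof -
  have "cinner v v = (\<Sum>i\<in>UNIV. complex_of_real ((norm (v $ i))\<^sup>2))"
    unfolding cinner_def by (intro sum.cong refl) (simp only: mult.commute[of "cnj _"] complex_norm_square)
  also have "\<dots> = complex_of_real ((norm v)\<^sup>2)"
    by (simp add: norm_vec_def L2_set_def sum_nonneg)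
  finally show ?thesis .
qed

text \<open>
  Indexing the eigenvectors by a set \<open>K\<close> of coordinates avoids counting dimensions: if
  \<open>k \<notin> K\<close>, the map \<open>v \<mapsto> (\<langle>u j, v\<rangle>)\<close> with \<open>j \<in> K\<close> misses \<open>axis k 1\<close>, so it has a kernel.
\<close>

lemma hermitian_eigenvectors:
  fixes A :: "complex^'n^'n" and K :: "'n set"
  assumes A: "hermitian A" and K: "finite K"
  shows "\<exists>u d. (\<forall>k\<in>K. A *v u k = (d k :: real) *\<^sub>R u k) \<and>
     (\<forall>j\<in>K. \<forall>k\<in>K. cinner (u j) (u k) = (if j = k then 1 else 0))"
  using K
proof (induction K)
  case (insert k K)
  then obtain u d where ud: "\<And>k. k \<in> K \<Longrightarrow> A *v u k = (d k :: real) *\<^sub>R u k"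
     "\<And>j k. j \<in> K \<Longrightarrow> k \<in> K \<Longrightarrow> cinner (u j) (u k) = (if j = k then 1 else 0)" by blast
  define W where "W = {v. \<forall>j\<in>K. cinner (u j) v = 0}"
  define L where "L v = (\<chi> j. if j \<in> K then cinner (u j) v else 0)" for v
  have L: "linear L"
    by (rule linearI) (simp_all add: L_def vec_eq_iff cinner_add_right cinner_scaleR_right)
  have "\<not> inj L"
  proof
    assume "inj L"
    with L have "surj L" by (rule eucl.linear_inj_imp_surj)
    then obtain v where "L v = axis k 1" by (metis surj_def)
    then have "L v $ k = 1" by simp
    then show False using insert.hyps by (simp add: L_def)
  qed
  then obtain v where v: "L v = 0" "v \<noteq> 0" using linear_injective_0[OF L] by blast
  have sW: "subspace W"
    unfolding W_def subspace_def
    by (auto simp: cinner_add_right cinner_scaleR_right) (simp add: cinner_def)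
  \<comment> \<open>The adjoint moves \<open>A\<close> onto the eigenvectors \<open>u j\<close>,
    which it only rescales.\<close>
  have AW: "A *v x \<in> W" if "x \<in> W" for x
    using that A by (auto simp: W_def cinner_matrix hermitian_def ud(1) cinner_scaleR_left)
  have vW: "v \<in> W"
  proof -
    have "cinner (u j) v = 0" if "j \<in> K" for j
      using arg_cong[OF v(1), of "\<lambda>z. z $ j"] that by (simp add: L_def)
    then show ?thesis by (simp add: W_def)
  qed
  have "inner (A *v x) y = inner x (A *v y)" for x y
    using A by (metis Re_cinner cinner_matrix hermitian_def)
  from selfadjoint_eigenvector[of "(*v) A", OF matrix_vector_mul_linear this sW AW vW v(2)]
  obtain e w where w: "w \<in> W" "norm w = 1" "A *v w = e *\<^sub>R w" by blast
  have ww: "cinner w w = 1" using w(2) by (simp add: cinner_self)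
  have wK: "cinner (u j) w = 0" "cinner w (u j) = 0" if "j \<in> K" for j
    using w(1) that cinner_commute[of w "u j"] by (auto simp: W_def)
  show ?case
    using insert.hyps ud w ww wK
    by (intro exI[of _ "u(k := w)"] exI[of _ "d(k := e)"]) auto
qed auto

theorem hermitian_spectral:
  fixes A :: "complex^'n^'n"
  assumes "hermitian A"
  obtains U d where "unitary U" "A = U ** diag_mat d ** dagger U"
proof -
  obtain u :: "'n \<Rightarrow> complex^'n" and d where
    ud: "\<And>k. A *v u k = (d k :: real) *\<^sub>R u k"
     "\<And>j k. cinner (u j) (u k) = (if j = k then 1 else 0)"
    using hermitian_eigenvectors[OF assms finite[of UNIV]] by auto
  define U where "U = (\<chi> i k. u k $ i)"
  have "dagger U ** U = mat 1"
    using ud(2) by (simp add: vec_eq_iff U_def matrix_matrix_mult_def cinner_def mat_def)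
  then have U: "unitary U" by (rule unitaryI)
  have "(A ** U) $ i $ k = (U ** diag_mat d) $ i $ k" for i k
    using arg_cong[OF ud(1)[of k], of "\<lambda>z. z $ i"]
    by (simp add: U_def matrix_matrix_mult_def[of A] matrix_vector_mult_def scaleR_conv_of_real[where 'a=complex] mult.commute)
  then have "A ** U = U ** diag_mat d" by (simp add: vec_eq_iff)
  then have "A = U ** diag_mat d ** dagger U"
    by (metis U matrix_mul_assoc matrix_mul_rid unitary_def)
  with U show thesis by (rule that)
qed

text \<open>Two diagonalizations of one matrix are linked by W = V^* U, whose entries satisfy W_ij
  d_j = e_i W_ij. Wherever W_ij is nonzero the eigenvalues coincide, so W also intertwines f(d) with
  f(e), and the description in \<open>mat_fun\<close> has a unique solution.\<close>

lemma mat_fun_unitary: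
  assumes U: "unitary U"
  shows "mat_fun f (U ** diag_mat d ** dagger U) = U ** diag_mat (f \<circ> d) ** dagger U"
  unfolding mat_fun_def
proof (rule the_equality)
  fix B assume "\<exists>V e. unitary V \<and> U ** diag_mat d ** dagger U = V ** diag_mat e ** dagger V \<and>
     B = V ** diag_mat (f \<circ> e) ** dagger V"
  then obtain V e where V: "unitary V" "U ** diag_mat d ** dagger U = V ** diag_mat e ** dagger V"
    "B = V ** diag_mat (f \<circ> e) ** dagger V" by blast
  define W where "W = dagger V ** U"
  have "W ** diag_mat d = dagger V ** (U ** diag_mat d ** dagger U) ** U"
    by (simp add: W_def matrix_mul_assoc[symmetric] unitary_cancel[OF U])
  also have "\<dots> = diag_mat e ** W"
    unfolding V(2) by (simp add: W_def matrix_mul_assoc[symmetric] unitary_cancel[OF V(1)])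
  finally have eq: "W $ i $ j * complex_of_real (d j) = complex_of_real (e i) * W $ i $ j" for i j
    by (metis diag_mat_mult_nth mult_diag_mat_nth)
  have "W $ i $ j * complex_of_real (f (d j)) = complex_of_real (f (e i)) * W $ i $ j" for i j
    using eq[of i j] by (cases "W $ i $ j = 0") auto
  then have "W ** diag_mat (f \<circ> d) = diag_mat (f \<circ> e) ** W" by (simp add: vec_eq_iff)
  then have "V ** (W ** diag_mat (f \<circ> d)) ** dagger U = V ** (diag_mat (f \<circ> e) ** W) ** dagger U" by simp
  then show "B = U ** diag_mat (f \<circ> d) ** dagger U"
    by (simp add: V(3) W_def matrix_mul_assoc[symmetric] unitary_cancel[OF U] unitary_cancel[OF V(1)])
qed (use U in blast)

lemma diag_mat_vector_nth: "(diag_mat d *v w) $ i = complex_of_real (d i) * w $ i"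
  by (simp add: matrix_vector_mult_def diag_mat_def if_distrib if_distribR cong: if_cong)

lemma diag_mat_axis: "diag_mat d *v axis i 1 = d i *\<^sub>R axis i 1"
  by (simp add: vec_eq_iff diag_mat_vector_nth axis_def scaleR_conv_of_real[where 'a=complex])

lemma pos_def_spectral:
  fixes A :: "complex^'n^'n"
  assumes "pos_def A"
  obtains U d where "unitary U" "A = U ** diag_mat d ** dagger U" "\<And>i. d i > 0"
proof -
  obtain U d where Ud: "unitary U" "A = U ** diag_mat d ** dagger U"
    using assms hermitian_spectral unfolding pos_def_def by blast
  have "d i > 0" for i
  proof -
    define v where "v = U *v axis i 1"
    have Uv: "dagger U *v v = axis i 1"
      by (simp add: v_def matrix_vector_mul_assoc unitary_cancel[OF Ud(1)])
    then have "v \<noteq> 0" by (metis axis_eq_0_iff matrix_vector_mult_0_right zero_neq_one)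
    then have "0 < Re (cinner v (A *v v))" using assms by (simp add: pos_def_def)
    also have "A *v v = U *v (diag_mat d *v axis i 1)"
      by (simp add: Ud(2) v_def matrix_vector_mul_assoc matrix_mul_assoc[symmetric] unitary_cancel[OF Ud(1)])
    also have "cinner v (U *v (diag_mat d *v axis i 1)) = cinner (axis i 1) (diag_mat d *v axis i 1)"
      by (simp add: cinner_matrix Uv)
    also have "\<dots> = d i"
      by (simp add: diag_mat_axis cinner_scaleR_right cinner_self scaleR_conv_of_real[where 'a=complex])
    finally show ?thesis by simp
  qed
  with Ud show thesis by (rule that)
qed

lemma hermitian_unitary_diag: "hermitian (U ** diag_mat d ** dagger U)"
  by (simp add: hermitian_def dagger_mult matrix_mul_assoc)

lemma pos_def_unitary_diag:
  fixes U :: "complex^'n^'n"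
  assumes U: "unitary U" and d: "\<And>i. d i > 0"
  shows "pos_def (U ** diag_mat d ** dagger U)"
  unfolding pos_def_def
proof (intro conjI allI impI hermitian_unitary_diag)
  fix v :: "complex^'n" assume "v \<noteq> 0"
  define w where "w = dagger U *v v"
  have "U *v w = v" by (simp add: w_def matrix_vector_mul_assoc unitary_cancel[OF U])
  then have "w \<noteq> 0" using \<open>v \<noteq> 0\<close> by auto
  then obtain k where k: "w $ k \<noteq> 0" by (auto simp: vec_eq_iff)
  have "cinner v (U ** diag_mat d ** dagger U *v v) = cinner w (diag_mat d *v w)"
    by (simp add: w_def matrix_vector_mul_assoc[symmetric] cinner_matrix)
  also have "Re \<dots> = (\<Sum>i\<in>UNIV. d i * (norm (w $ i))\<^sup>2)"
    unfolding cmod_def by (simp add: cinner_def diag_mat_vector_nth power2_eq_square algebra_simps)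
  also have "\<dots> > 0"
    using d k by (intro sum_pos2[of _ k]) (auto intro: mult_nonneg_nonneg[OF less_imp_le])
  finally show "0 < Re (cinner v (U ** diag_mat d ** dagger U *v v))" .
qed

lemma pos_def_imp_hermitian: "pos_def A \<Longrightarrow> hermitian A"
  by (simp add: pos_def_def)

lemma unitary_diag_mult:
  assumes "unitary U"
  shows "(U ** diag_mat d ** dagger U) ** (U ** diag_mat e ** dagger U) =
    U ** diag_mat (\<lambda>i. d i * e i) ** dagger U"
  by (simp add: matrix_mul_assoc[symmetric] unitary_cancel[OF assms] flip: diag_mat_mult)

lemma unitary_diag_scaleR:
  "c *\<^sub>R (U ** diag_mat d ** dagger U) = U ** diag_mat (\<lambda>i. c * d i) ** dagger U"
proof -
  have "diag_mat (\<lambda>i. c * d i) = c *\<^sub>R diag_mat d" by (simp add: vec_eq_iff diag_mat_def scaleR_conv_of_real[where 'a=complex])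
  then show ?thesis by (simp add: matrix_scalar_ac scalar_matrix_assoc[symmetric])
qed

section \<open>Algebraic rules of the functional calculus\<close>

lemma mat_fun_mult:
  assumes "hermitian A"
  shows "mat_fun f A ** mat_fun g A = mat_fun (\<lambda>t. f t * g t) A"
  using assms by (rule hermitian_spectral) (simp add: mat_fun_unitary unitary_diag_mult o_def)

lemma mat_fun_compose:
  assumes "hermitian A"
  shows "mat_fun g (mat_fun f A) = mat_fun (g \<circ> f) A"
  using assms by (rule hermitian_spectral) (simp add: mat_fun_unitary o_assoc)

lemma mat_fun_ident:
  assumes "hermitian A"
  shows "mat_fun (\<lambda>t. t) A = A"
  using assms by (rule hermitian_spectral) (simp add: mat_fun_unitary o_def)

lemma mat_fun_const_1:
  assumes "hermitian A"
  shows "mat_fun (\<lambda>t. 1) A = mat 1"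
proof -
  have "diag_mat (\<lambda>i. 1) = (mat 1 :: complex^'a^'a)" by (simp add: vec_eq_iff diag_mat_def mat_def)
  with assms show ?thesis
    by (elim hermitian_spectral) (simp add: mat_fun_unitary o_def unitary_cancel)
qed

lemma mat_fun_scaleR:
  assumes "hermitian A"
  shows "mat_fun f (c *\<^sub>R A) = mat_fun (\<lambda>t. f (c * t)) A"
  using assms by (rule hermitian_spectral) (simp add: mat_fun_unitary unitary_diag_scaleR o_def)

lemma scaleR_mat_fun:
  assumes "hermitian A"
  shows "c *\<^sub>R mat_fun f A = mat_fun (\<lambda>t. c * f t) A"
  using assms by (rule hermitian_spectral) (simp add: mat_fun_unitary unitary_diag_scaleR o_def)

text \<open>Scalar identities for powers, logarithms and inverses are available on the positive
  half-line, and the spectrum of a positive definite matrix stays there.\<close>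

lemma mat_fun_cong_pos:
  assumes "pos_def A" "\<And>t. t > 0 \<Longrightarrow> f t = g t"
  shows "mat_fun f A = mat_fun g A"
proof -
  obtain U d where "unitary U" "A = U ** diag_mat d ** dagger U" "\<And>i. d i > 0"
    using pos_def_spectral[OF assms(1)] by metis
  moreover from this(3) assms(2) have "f \<circ> d = g \<circ> d" by auto
  ultimately show ?thesis by (simp add: mat_fun_unitary)
qed

lemma hermitian_mat_fun: "hermitian A \<Longrightarrow> hermitian (mat_fun f A)"
  by (erule hermitian_spectral) (simp add: mat_fun_unitary hermitian_unitary_diag)

lemma pos_def_mat_fun:
  assumes "pos_def A" "\<And>t. t > 0 \<Longrightarrow> f t > 0"
  shows "pos_def (mat_fun f A)"
proof -
  obtain U d where "unitary U" "A = U ** diag_mat d ** dagger U" "\<And>i. d i > 0"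
    using pos_def_spectral[OF assms(1)] by metis
  then show ?thesis using assms(2) by (simp add: mat_fun_unitary pos_def_unitary_diag)
qed

lemma trace_mult_commute: "trace (A ** B) = trace (B ** A)" for A :: "complex^'n^'m"
  unfolding trace_def matrix_matrix_mult_def
  by (simp, subst sum.swap, simp add: mult.commute)

section \<open>Derivatives of the functional calculus\<close>

lemma bounded_bilinear_matrix_mult:
  "bounded_bilinear ((**) :: complex^'n^'m \<Rightarrow> complex^'k^'n \<Rightarrow> complex^'k^'m)"
  by (subst bilinear_conv_bounded_bilinear[symmetric])
    (simp add: bilinear_def linear_iff vec_eq_iff matrix_matrix_mult_def sum.distrib scaleR_sum_right
      distrib_left distrib_right)

lemmas bounded_linear_matrix_mult_left = bounded_bilinear.bounded_linear_left[OF bounded_bilinear_matrix_mult]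
lemmas bounded_linear_matrix_mult_right = bounded_bilinear.bounded_linear_right[OF bounded_bilinear_matrix_mult]

lemma bounded_linear_trace: "bounded_linear (trace :: complex^'n^'n \<Rightarrow> complex)"
  by (subst linear_conv_bounded_linear[symmetric])
    (simp add: linear_iff trace_def sum.distrib scaleR_sum_right)

lemmas matrix_mult_simps =
  bounded_bilinear.diff_left[OF bounded_bilinear_matrix_mult]
  bounded_bilinear.diff_right[OF bounded_bilinear_matrix_mult]
  bounded_bilinear.add_left[OF bounded_bilinear_matrix_mult]
  bounded_bilinear.add_right[OF bounded_bilinear_matrix_mult]
  bounded_bilinear.scaleR_left[OF bounded_bilinear_matrix_mult]
  bounded_bilinear.scaleR_right[OF bounded_bilinear_matrix_mult]
  bounded_bilinear.zero_left[OF bounded_bilinear_matrix_mult]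
  bounded_bilinear.zero_right[OF bounded_bilinear_matrix_mult]

lemmas trace_scaleR = linear_scale[OF bounded_linear.linear[OF bounded_linear_trace]]

definition matop :: "complex^'n^'n \<Rightarrow> ((complex^'n) \<Rightarrow>\<^sub>L (complex^'n))" where
  "matop A = Blinfun ((*v) A)"

lemma matop_apply [simp]: "blinfun_apply (matop A) v = A *v v"
  unfolding matop_def
  by (subst bounded_linear_Blinfun_apply) (simp_all add: linear_conv_bounded_linear[symmetric])

lemma bounded_linear_matop: "bounded_linear matop"
  by (subst linear_conv_bounded_linear[symmetric], rule linearI)
    (auto intro!: blinfun_eqI simp: blinfun.add_left blinfun.scaleR_left vec_eq_iff
      matrix_vector_mult_def sum.distrib scaleR_sum_right algebra_simps)

text \<open>Bounded operators are only real linear here, so \<open>matop\<close> need not be onto.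
  Reading off the images of the standard basis vectors as columns gives a bounded linear left
  inverse.\<close>

definition opmat :: "((complex^'n) \<Rightarrow>\<^sub>L (complex^'n)) \<Rightarrow> complex^'n^'n" where
  "opmat E = (\<Sum>j\<in>UNIV. (\<chi> i k. if k = j then (blinfun_apply E (axis j 1)) $ i else 0))"

lemma bounded_linear_opmat: "bounded_linear opmat"
proof -
  have "bounded_linear (\<lambda>v. (\<chi> i k. if k = j then v $ i else 0) :: complex^'n^'n)" for j :: "'n::finite"
    by (subst linear_conv_bounded_linear[symmetric]) (simp add: linear_iff vec_eq_iff)
  then show ?thesis
    unfolding opmat_def
    by (intro bounded_linear_sum bounded_linear_compose[OF _ blinfun.bounded_linear_left])
qed

lemma opmat_matop [simp]: "opmat (matop A) = A"
  by (simp add: opmat_def vec_eq_iff matrix_vector_mult_def axis_def if_distrib cong: if_cong)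

section \<open>Matrix powers and traces of their derivatives\<close>

primrec matpow :: "complex^'n^'n \<Rightarrow> nat \<Rightarrow> complex^'n^'n" where
  "matpow A 0 = mat 1"
| "matpow A (Suc k) = A ** matpow A k"

primrec matpow_deriv :: "complex^'n^'n \<Rightarrow> nat \<Rightarrow> complex^'n^'n \<Rightarrow> complex^'n^'n" where
  "matpow_deriv A 0 H = 0"
| "matpow_deriv A (Suc k) H = H ** matpow A k + A ** matpow_deriv A k H"

lemma matop_mult: "matop A o\<^sub>L matop B = matop (A ** B)"
  by (rule blinfun_eqI) (simp add: matrix_vector_mul_assoc)

lemma blinfun_pow_matop: "blinfun_pow (matop A) k = matop (matpow A k)"
  by (induction k) (auto simp: matop_mult intro: blinfun_eqI)

lemma blinfun_pow_deriv_matop: "blinfun_apply (blinfun_pow_deriv (matop A) k) (matop H) = matop (matpow_deriv A k H)"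
proof (induction k)
  case 0
  then show ?case by (simp add: linear_0[OF bounded_linear.linear[OF bounded_linear_matop]])
next
  case (Suc k)
  then show ?case
    by (simp add: blinfun.add_left blinfun_pow_matop matop_mult
        linear_add[OF bounded_linear.linear[OF bounded_linear_matop]])
qed

lemma matpow_commute: "B ** A = A ** B \<Longrightarrow> B ** matpow A k = matpow A k ** B"
  by (induction k) (simp_all, metis matrix_mul_assoc)

text \<open>Under the trace each of the k terms A^i H A^j can be rotated cyclically to B A^(k-1) H,
  because \<open>B\<close> commutes with \<open>A\<close>. The induction varies \<open>B\<close>,
  since each step absorbs a factor \<open>A\<close> into it. At k = 0 the truncated exponent is
  harmless: the factor k vanishes.\<close>

lemma trace_matpow_deriv:
  assumes "B ** A = A ** B"
  shows "trace (B ** matpow_deriv A k H) = real k *\<^sub>R trace (B ** matpow A (k - 1) ** H)"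
  using assms
proof (induction k arbitrary: B)
  case 0
  then show ?case by (simp add: trace_def)
next
  case (Suc k)
  have "trace (B ** (H ** matpow A k)) = trace (matpow A k ** B ** H)"
    by (metis matrix_mul_assoc trace_mult_commute)
  also have "\<dots> = trace (B ** matpow A k ** H)" by (simp add: matpow_commute[OF Suc.prems])
  finally have 1: "trace (B ** (H ** matpow A k)) = trace (B ** matpow A k ** H)" .
  have "(B ** A) ** A = A ** (B ** A)" by (metis Suc.prems matrix_mul_assoc)
  from Suc.IH[OF this] have "trace (B ** A ** matpow_deriv A k H) = real k *\<^sub>R trace (B ** A ** matpow A (k - 1) ** H)" .
  also have "\<dots> = real k *\<^sub>R trace (B ** matpow A k ** H)"
    by (cases k) (simp_all add: matrix_mul_assoc)
  finally show ?case
    using 1 by (simp add: matrix_add_ldistrib trace_add matrix_mul_assoc scaleR_left_distrib)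
qed

lemma matpow_unitary_diag:
  assumes "unitary U"
  shows "matpow (U ** diag_mat d ** dagger U) k = U ** diag_mat (\<lambda>i. d i ^ k) ** dagger U"
proof (induction k)
  case 0
  have "diag_mat (\<lambda>i. 1) = (mat 1 :: complex^'a^'a)" by (simp add: vec_eq_iff diag_mat_def mat_def)
  then show ?case by (simp add: unitary_cancel[OF assms])
qed (simp add: unitary_diag_mult[OF assms])

text \<open>A diagonal matrix is a finite combination of fixed matrix units, so convergence at each
  eigenvalue passes to the matrices.\<close>

lemma unitary_diag_sums:
  assumes "\<And>i. (\<lambda>k. s k i) sums g i"
  shows "(\<lambda>k. U ** diag_mat (s k) ** dagger U) sums (U ** diag_mat g ** dagger U)"
proof -
  have eq: "diag_mat d = (\<Sum>i\<in>UNIV. d i *\<^sub>R diag_mat (\<lambda>j. if j = i then 1 else 0))" for d :: "'a \<Rightarrow> real"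
  proof -
    have "(d x *\<^sub>R diag_mat (\<lambda>j. if j = x then 1 else 0)) $ i $ j =
        (if x = i then diag_mat d $ i $ j else 0)" for x i j
      by (simp add: diag_mat_def scaleR_conv_of_real[where 'a=complex])
    then show ?thesis by (simp add: vec_eq_iff)
  qed
  have "(\<lambda>k. \<Sum>i\<in>UNIV. s k i *\<^sub>R diag_mat (\<lambda>j. if j = i then 1 else 0)) sums
      (\<Sum>i\<in>UNIV. g i *\<^sub>R diag_mat (\<lambda>j. if j = i then 1 else 0))"
    using assms by (intro sums_sum sums_scaleR_left)
  then have "(\<lambda>k. diag_mat (s k)) sums diag_mat g" unfolding eq[symmetric] .
  then show ?thesis
    by (intro bounded_linear.sums[OF bounded_linear_matrix_mult_left] bounded_linear.sums[OF bounded_linear_matrix_mult_right])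
qed

lemma norm_unitary_mult:
  assumes "unitary U"
  shows "norm (U *v v) = norm v"
proof -
  have "cinner (U *v v) (U *v v) = cinner v v"
    by (simp add: cinner_matrix matrix_vector_mul_assoc unitary_cancel[OF assms])
  then show ?thesis by (simp add: cinner_self flip: of_real_power)
qed

lemma unitary_dagger: "unitary U \<Longrightarrow> unitary (dagger U)"
  by (simp add: unitary_def)

text \<open>Together the bounds identify the operator norm with the largest absolute eigenvalue. The
  first puts the reference matrix inside the disc of convergence, the second keeps the eigenvalues
  of nearby Hermitian matrices inside it.\<close>

lemma norm_matop_unitary_diag:
  assumes U: "unitary U"
  shows norm_matop_le: "(\<And>i. \<bar>d i\<bar> \<le> r) \<Longrightarrow> norm (matop (U ** diag_mat d ** dagger U)) \<le> r"
    and eigenvalue_le_norm_matop: "\<bar>d i\<bar> \<le> norm (matop (U ** diag_mat d ** dagger U))"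
proof -
  assume d: "\<And>i. \<bar>d i\<bar> \<le> r"
  then have r: "0 \<le> r" using abs_ge_zero order_trans by blast
  show "norm (matop (U ** diag_mat d ** dagger U)) \<le> r"
  proof (rule norm_blinfun_bound[OF r])
    fix v
    have "norm (blinfun_apply (matop (U ** diag_mat d ** dagger U)) v) = norm (diag_mat d *v (dagger U *v v))"
      by (simp add: norm_unitary_mult[OF U] flip: matrix_vector_mul_assoc)
    also have "\<dots> \<le> norm (r *\<^sub>R (dagger U *v v))"
      by (rule norm_le_componentwise_cart)
        (use d r in \<open>simp add: diag_mat_vector_nth norm_mult mult_right_mono\<close>)
    also have "\<dots> = r * norm v" using r by (simp add: norm_unitary_mult unitary_dagger U)
    finally show "norm (blinfun_apply (matop (U ** diag_mat d ** dagger U)) v) \<le> r * norm v" .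
  qed
next
  define v where "v = U *v axis i 1"
  have "U ** diag_mat d ** dagger U *v v = U *v (d i *\<^sub>R axis i 1)"
    by (simp add: v_def matrix_vector_mul_assoc matrix_mul_assoc[symmetric] unitary_cancel[OF U]
        flip: diag_mat_axis)
  then have "norm (blinfun_apply (matop (U ** diag_mat d ** dagger U)) v) = \<bar>d i\<bar>"
    by (simp add: norm_unitary_mult[OF U])
  moreover have "norm v = 1" by (simp add: v_def norm_unitary_mult[OF U])
  ultimately show "\<bar>d i\<bar> \<le> norm (matop (U ** diag_mat d ** dagger U))"
    using norm_blinfun[of "matop (U ** diag_mat d ** dagger U)" v] by simp
qed

text \<open>
  \<open>f\<close> is analytic on every disc with centre \<open>c > 0\<close> and radius \<open>c\<close>, written in the variable
  \<open>u = t / c - 1\<close>; any compact part of the positive half-line lies in such a disc.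
\<close>

definition disc_analytic :: "(real \<Rightarrow> real) \<Rightarrow> bool" where
  "disc_analytic f \<longleftrightarrow> (\<forall>c>0. \<exists>a. \<forall>u. \<bar>u\<bar> < 1 \<longrightarrow> (\<lambda>k. a k * u ^ k) sums f (c * (1 + u)))"

lemma disc_analytic_powr: "disc_analytic (\<lambda>t. t powr s)"
  unfolding disc_analytic_def
proof (intro allI impI exI)
  fix c u :: real assume "c > 0" "\<bar>u\<bar> < 1"
  then have "(\<lambda>k. c powr s * ((s gchoose k) * u ^ k)) sums (c powr s * (1 + u) powr s)"
    by (intro sums_mult gen_binomial_real)
  then show "(\<lambda>k. (c powr s * (s gchoose k)) * u ^ k) sums (c * (1 + u)) powr s"
    using \<open>c > 0\<close> \<open>\<bar>u\<bar> < 1\<close> by (simp add: powr_mult mult.assoc)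
qed

lemma disc_analytic_ln: "disc_analytic ln"
  unfolding disc_analytic_def
proof (intro allI impI exI)
  fix c u :: real assume c: "c > 0" and u: "\<bar>u\<bar> < 1"
  then have "0 < 1 + u" by linarith
  let ?a = "\<lambda>k. (if k = 0 then ln c else - ((-1) ^ k) / of_nat k)"
  \<comment> \<open>Division by zero makes the term at n = 0 vanish, which leaves that place free
    for the constant ln c.\<close>
  have "(\<lambda>n. - ((- u) ^ n) / of_nat n) sums ln (1 + u)"
    using ln_series'[of u] u by simp
  then have "(\<lambda>n. (if n = 0 then ln c else 0) + - ((- u) ^ n) / of_nat n) sums (ln c + ln (1 + u))"
    by (intro sums_add sums_single)
  also have "(\<lambda>n. (if n = 0 then ln c else 0) + - ((- u) ^ n) / of_nat n) = (\<lambda>k. ?a k * u ^ k)"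
    by (auto simp: power_minus[of u])
  finally show "(\<lambda>k. ?a k * u ^ k) sums ln (c * (1 + u))"
    using c \<open>0 < 1 + u\<close> by (simp add: ln_mult)
qed

lemma unitary_diag_affine:
  assumes "unitary U"
  shows "c *\<^sub>R (U ** diag_mat d ** dagger U) - mat 1 = U ** diag_mat (\<lambda>i. c * d i - 1) ** dagger U"
proof -
  have "diag_mat (\<lambda>i. c * d i - 1) = c *\<^sub>R diag_mat d - mat 1"
    by (simp add: vec_eq_iff diag_mat_def mat_def scaleR_conv_of_real[where 'a=complex])
  then show ?thesis by (simp add: matrix_mult_simps unitary_cancel[OF assms])
qed

text \<open>The norm bound places every eigenvalue in the disc, where the scalar series converges;
  diagonalization lifts this to matrices. The second claim admits arbitrary exponents
  \<open>m k\<close>, so that a termwise differentiated series with exponents k - 1 fits without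
  reindexing.\<close>

lemma mat_fun_eq_powser:
  fixes A :: "complex^'n^'n"
  assumes a: "\<And>u. \<bar>u\<bar> < 1 \<Longrightarrow> (\<lambda>k. a k * u ^ k) sums f (c * (1 + u))"
    and c: "c > 0" and A: "hermitian A"
    and n: "norm (matop ((1 / c) *\<^sub>R A - mat 1)) < 1"
  shows "mat_fun f A = opmat (blinfun_powser a (matop ((1 / c) *\<^sub>R A - mat 1)))"
    and "(\<And>u. \<bar>u\<bar> < 1 \<Longrightarrow> (\<lambda>k. b k * u ^ m k) sums g (c * (1 + u))) \<Longrightarrow>
      (\<lambda>k. b k *\<^sub>R matpow ((1 / c) *\<^sub>R A - mat 1) (m k)) sums mat_fun g A"
proof -
  obtain U d where U: "unitary U" and Ad: "A = U ** diag_mat d ** dagger U"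
    using A by (rule hermitian_spectral)
  define e where "e = (\<lambda>i. 1 / c * d i - 1)"
  have de: "d i = c * (1 + e i)" for i using c by (simp add: e_def)
  have M: "(1 / c) *\<^sub>R A - mat 1 = U ** diag_mat e ** dagger U"
    unfolding Ad e_def by (rule unitary_diag_affine[OF U])
  have e: "\<bar>e i\<bar> < 1" for i
    using eigenvalue_le_norm_matop[OF U, of e i] n unfolding M by linarith
  have gen: "(\<lambda>k. b k *\<^sub>R matpow ((1 / c) *\<^sub>R A - mat 1) (m k)) sums mat_fun g A"
    if "\<And>u. \<bar>u\<bar> < 1 \<Longrightarrow> (\<lambda>k. b k * u ^ m k) sums g (c * (1 + u))" for b g m
  proof -
    have "(\<lambda>k. U ** diag_mat (\<lambda>i. b k * e i ^ m k) ** dagger U) sums (U ** diag_mat (g \<circ> d) ** dagger U)"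
      by (rule unitary_diag_sums) (use that[OF e] in \<open>simp add: de\<close>)
    then show ?thesis
      unfolding M matpow_unitary_diag[OF U] unitary_diag_scaleR by (simp add: Ad mat_fun_unitary[OF U])
  qed
  show "(\<And>u. \<bar>u\<bar> < 1 \<Longrightarrow> (\<lambda>k. b k * u ^ m k) sums g (c * (1 + u))) \<Longrightarrow>
      (\<lambda>k. b k *\<^sub>R matpow ((1 / c) *\<^sub>R A - mat 1) (m k)) sums mat_fun g A" by (rule gen)
  have "(\<lambda>k. a k *\<^sub>R blinfun_pow (matop ((1 / c) *\<^sub>R A - mat 1)) k) sums
      blinfun_powser a (matop ((1 / c) *\<^sub>R A - mat 1))"
    by (rule blinfun_powser_sums[OF _ n]) (use a sums_summable in blast)
  from bounded_linear.sums[OF bounded_linear_opmat this]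
  have "(\<lambda>k. a k *\<^sub>R matpow ((1 / c) *\<^sub>R A - mat 1) k) sums
      opmat (blinfun_powser a (matop ((1 / c) *\<^sub>R A - mat 1)))"
    by (simp add: blinfun_pow_matop linear_scale[OF bounded_linear.linear[OF bounded_linear_opmat]])
  with gen[of a "\<lambda>k. k" f, OF a] show "mat_fun f A = opmat (blinfun_powser a (matop ((1 / c) *\<^sub>R A - mat 1)))"
    by (rule sums_unique2)
qed

text \<open>With \<open>c\<close> fixed by the spectrum at \<open>t0\<close>, the norm condition is
  open, so one power series represents f(X t) for all t near \<open>t0\<close>. Differentiating it
  termwise and tracing against a matrix that commutes with X t0 turns each term into k a_k M^(k-1),
  and these sum to f'(X t0) up to the scale c.\<close>

lemma mat_fun_curve:
  fixes X :: "'e::real_normed_vector \<Rightarrow> complex^'n^'n"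
  assumes f: "disc_analytic f" and X: "twice_diff_at X t0"
    and herm: "\<forall>\<^sub>F t in nhds t0. hermitian (X t)" and pd: "pos_def (X t0)"
  shows twice_diff_at_mat_fun: "twice_diff_at (\<lambda>t. mat_fun f (X t)) t0"
    and trace_derivative_mat_fun:
      "\<lbrakk>(X has_derivative X') (at t0); \<And>t. t > 0 \<Longrightarrow> (f has_field_derivative f' t) (at t)\<rbrakk> \<Longrightarrow>
      \<exists>Z. ((\<lambda>t. mat_fun f (X t)) has_derivative Z) (at t0) \<and>
        (\<forall>B h. B ** X t0 = X t0 ** B \<longrightarrow> trace (B ** Z h) = trace (B ** mat_fun f' (X t0) ** X' h))"
proof -
  obtain U d where U: "unitary U" and Xd: "X t0 = U ** diag_mat d ** dagger U" and d: "\<And>i. d i > 0"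
    using pos_def_spectral[OF pd] by metis
  \<comment> \<open>The eigenvalues are positive, so their sum bounds each of them, and every d i /
    c - 1 lies in the half-open interval from -1 (excluded) to 0.\<close>
  define c where "c = sum d UNIV"
  have dc: "d i \<le> c" for i unfolding c_def using d by (intro member_le_sum) (auto intro: less_imp_le)
  have c: "c > 0" using d dc less_le_trans by blast
  obtain a where a: "\<And>u. \<bar>u\<bar> < 1 \<Longrightarrow> (\<lambda>k. a k * u ^ k) sums f (c * (1 + u))"
    using f c unfolding disc_analytic_def by blast
  have sa: "summable (\<lambda>k. a k * u ^ k)" if "\<bar>u\<bar> < 1" for u using a[OF that] by (rule sums_summable)
  define M where "M = (\<lambda>t. (1 / c) *\<^sub>R X t - mat 1)"
  define G where "G = (\<lambda>t. matop (M t))"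
  define e where "e = (\<lambda>i. 1 / c * d i - 1)"
  have M0: "M t0 = U ** diag_mat e ** dagger U"
    unfolding M_def Xd e_def by (rule unitary_diag_affine[OF U])
  \<comment> \<open>A maximum over finitely many eigenvalues turns the strict bounds into one bound
    below 1, as \<open>norm_matop_le\<close> yields only a weak inequality.\<close>
  define r where "r = Max (range (\<lambda>i. \<bar>e i\<bar>))"
  have "\<bar>e i\<bar> < 1" for i using d[of i] dc[of i] c by (auto simp: e_def abs_if field_simps)
  then have r: "r < 1" unfolding r_def by (subst Max_less_iff) auto
  have "norm (G t0) \<le> r" unfolding G_def M0
    by (rule norm_matop_le[OF U]) (auto simp: r_def intro: Max_ge)
  with r have G0: "norm (G t0) < 1" by simp
  have M_lin: "M = (\<lambda>t. (1 / c) *\<^sub>R X t + (- mat 1))" by (simp add: M_def)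
  have "twice_diff_at M t0"
    unfolding M_lin
    by (intro twice_diff_at_add twice_diff_at_const twice_diff_at_linear_compose[OF bounded_linear_scaleR_right X])
  then have G: "twice_diff_at G t0"
    unfolding G_def by (rule twice_diff_at_linear_compose[OF bounded_linear_matop])
  have "\<forall>\<^sub>F y in nhds (G t0). norm y < 1"
    using eventually_nhds_in_open[of "ball 0 1" "G t0"] G0 by simp
  with twice_diff_at_imp_isCont[OF G] have evG: "\<forall>\<^sub>F t in nhds t0. norm (G t) < 1"
    by (rule eventually_nhds_compose)
  have ev: "\<forall>\<^sub>F t in nhds t0. opmat (blinfun_powser a (G t)) = mat_fun f (X t)"
    using evG herm
    by eventually_elim (simp add: mat_fun_eq_powser(1)[OF a c] G_def M_def)
  have "twice_diff_at (\<lambda>t. opmat (blinfun_powser a (G t))) t0"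
    by (intro twice_diff_at_linear_compose[OF bounded_linear_opmat] twice_diff_at_compose[OF G]
        twice_diff_at_blinfun_powser sa G0)
  with ev show "twice_diff_at (\<lambda>t. mat_fun f (X t)) t0" by (rule twice_diff_at_cong)
  assume X': "(X has_derivative X') (at t0)"
    and f': "\<And>t. t > 0 \<Longrightarrow> (f has_field_derivative f' t) (at t)"
  define D where "D = (\<Sum>k. a k *\<^sub>R blinfun_pow_deriv (G t0) k)"
  have D: "(blinfun_powser a has_derivative blinfun_apply D) (at (G t0))"
    unfolding D_def by (rule has_derivative_blinfun_powser[OF _ G0], rule sa)
  have sD: "(\<lambda>k. a k *\<^sub>R blinfun_pow_deriv (G t0) k) sums D"
    unfolding D_def by (rule summable_sums, rule summable_blinfun_pow_deriv[OF _ G0], rule sa)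
  have "(G has_derivative (\<lambda>h. matop ((1 / c) *\<^sub>R X' h))) (at t0)"
    unfolding G_def M_lin
    by (rule bounded_linear.has_derivative[OF bounded_linear_matop])
      (use has_derivative_add[OF has_derivative_scaleR_right[OF X'] has_derivative_const, of "1 / c" "- mat 1"] in simp)
  from diff_chain_at[OF this D]
  have "((\<lambda>t. opmat (blinfun_powser a (G t))) has_derivative (\<lambda>h. opmat (D (matop ((1 / c) *\<^sub>R X' h))))) (at t0)"
    by (intro bounded_linear.has_derivative[OF bounded_linear_opmat]) (simp add: o_def)
  with ev have der: "((\<lambda>t. mat_fun f (X t)) has_derivative (\<lambda>h. opmat (D (matop ((1 / c) *\<^sub>R X' h))))) (at t0)"
    by (rule has_derivative_eventually_cong)
  \<comment> \<open>The scalar series and v \<mapsto> f(c (1 + v)) agree near \<open>u\<close>, so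
    uniqueness of the derivative equates the differentiated series with c f'(c (1 + u)); dividing by
    c gives the coefficients.\<close>
  have pow: "(\<lambda>k. (real k * a k / c) * u ^ (k - 1)) sums f' (c * (1 + u))" if u: "\<bar>u\<bar> < 1" for u
  proof -
    have "((\<lambda>u. \<Sum>k. a k * u ^ k) has_field_derivative (\<Sum>k. diffs a k * u ^ k)) (at u)"
      by (rule termdiffs_strong'[where K=1]) (use sa u in auto)
    moreover have "\<forall>\<^sub>F v in nhds u. (\<Sum>k. a k * v ^ k) = f (c * (1 + v))"
      using eventually_nhds_in_open[of "{-1<..<1}" u] u
      by (auto elim!: eventually_mono intro!: sums_unique[symmetric] a simp: abs_less_iff)
    ultimately have 1: "((\<lambda>v. f (c * (1 + v))) has_field_derivative (\<Sum>k. diffs a k * u ^ k)) (at u)"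
      by (subst (asm) DERIV_cong_ev[OF refl _ refl]) auto
    have pos: "c * (1 + u) > 0" using c u by (intro mult_pos_pos) auto
    have "((\<lambda>v. c * (1 + v)) has_field_derivative c) (at u)"
      by (auto intro!: derivative_eq_intros)
    from DERIV_chain2[OF f'[OF pos] this]
    have 2: "(\<Sum>k. diffs a k * u ^ k) = f' (c * (1 + u)) * c" using 1 DERIV_unique by blast
    have "summable (\<lambda>k. diffs a k * u ^ k)"
      by (rule termdiff_converges[where K=1]) (use sa u in auto)
    from diffs_equiv[OF this] have "(\<lambda>k. (real k * a k * u ^ (k - 1)) / c) sums (f' (c * (1 + u)) * c / c)"
      unfolding 2 by (intro sums_divide) simp
    then show ?thesis using c by (simp add: divide_simps)
  qed
  have tr: "trace (B ** opmat (D (matop ((1 / c) *\<^sub>R X' h)))) = trace (B ** mat_fun f' (X t0) ** X' h)"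
    if B: "B ** X t0 = X t0 ** B" for B h
  proof -
    have BM: "B ** M t0 = M t0 ** B"
      using B by (simp add: M_def matrix_mult_simps)
    \<comment> \<open>This bounded linear functional of the derivative operator can be taken through
      the series that defines \<open>D\<close>.\<close>
    have bl: "bounded_linear (\<lambda>E. trace (B ** opmat (blinfun_apply E (matop ((1 / c) *\<^sub>R X' h)))))"
      by (intro bounded_linear_compose[OF bounded_linear_trace] bounded_linear_compose[OF bounded_linear_matrix_mult_right]
          bounded_linear_compose[OF bounded_linear_opmat] blinfun.bounded_linear_left)
    have "trace (B ** opmat (blinfun_apply (a k *\<^sub>R blinfun_pow_deriv (G t0) k) (matop ((1 / c) *\<^sub>R X' h)))) =
      trace (B ** ((real k * a k / c) *\<^sub>R matpow (M t0) (k - 1)) ** X' h)" for k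
    proof -
      have "trace (B ** opmat (blinfun_apply (blinfun_pow_deriv (G t0) k) (matop ((1 / c) *\<^sub>R X' h)))) =
          real k *\<^sub>R trace (B ** matpow (M t0) (k - 1) ** ((1 / c) *\<^sub>R X' h))"
        by (simp add: G_def blinfun_pow_deriv_matop trace_matpow_deriv[OF BM])
      then show ?thesis
        by (simp add: linear_scale[OF bounded_linear.linear[OF bl]] matrix_mult_simps trace_scaleR)
    qed
    with bounded_linear.sums[OF bl sD]
    have 1: "(\<lambda>k. trace (B ** ((real k * a k / c) *\<^sub>R matpow (M t0) (k - 1)) ** X' h)) sums
      trace (B ** opmat (D (matop ((1 / c) *\<^sub>R X' h))))" by simp
    have "hermitian (X t0)" using pd by (simp add: pos_def_def)
    from mat_fun_eq_powser(2)[OF a c this _ pow] G0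
    have "(\<lambda>k. (real k * a k / c) *\<^sub>R matpow (M t0) (k - 1)) sums mat_fun f' (X t0)"
      by (simp add: G_def M_def)
    then have "(\<lambda>k. trace (B ** ((real k * a k / c) *\<^sub>R matpow (M t0) (k - 1)) ** X' h)) sums
        trace (B ** mat_fun f' (X t0) ** X' h)"
      by (intro bounded_linear.sums[OF bounded_linear_trace] bounded_linear.sums[OF bounded_linear_matrix_mult_left]
          bounded_linear.sums[OF bounded_linear_matrix_mult_right])
    with 1 show ?thesis by (rule sums_unique2)
  qed
  show "\<exists>Z. ((\<lambda>t. mat_fun f (X t)) has_derivative Z) (at t0) \<and>
        (\<forall>B h. B ** X t0 = X t0 ** B \<longrightarrow> trace (B ** Z h) = trace (B ** mat_fun f' (X t0) ** X' h))"
    using der tr by blast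
qed

section \<open>Second partial derivatives\<close>

lemma has_vector_derivative_line:
  assumes "(f has_derivative D) (at x)"
  shows "((\<lambda>t. f (x + t *\<^sub>R axis j 1)) has_vector_derivative D (axis j 1)) (at 0)"
proof -
  interpret D: bounded_linear D using assms by (rule has_derivative_bounded_linear)
  have "((\<lambda>t. x + t *\<^sub>R axis j 1) has_derivative (\<lambda>t. t *\<^sub>R axis j 1)) (at 0)"
    by (auto intro!: derivative_eq_intros)
  from diff_chain_at[OF this, of f D] assms show ?thesis
    by (simp add: has_vector_derivative_def o_def D.scaleR)
qed

lemma partial_deriv_eqI: "(f has_derivative D) (at x) \<Longrightarrow> partial_deriv j f x = D (axis j 1)"
  unfolding partial_deriv_def by (rule vector_derivative_at[OF has_vector_derivative_line])

text \<open>\<open>vector_derivative\<close> chooses among the candidate derivatives. Functions that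
  agree near \<open>x\<close> have the same candidates, hence the same chosen value, whether or not
  a derivative exists.\<close>

lemma partial_deriv_cong:
  assumes "\<forall>\<^sub>F y in nhds x. f y = g y"
  shows "partial_deriv j f x = partial_deriv j g x"
proof -
  have "isCont (\<lambda>t. x + t *\<^sub>R axis j 1) 0" by (intro continuous_intros)
  from eventually_nhds_compose[OF this, of "\<lambda>y. f y = g y"] assms
  have ev: "\<forall>\<^sub>F t in nhds 0. f (x + t *\<^sub>R axis j 1) = g (x + t *\<^sub>R axis j 1)" by simp
  then have ev': "\<forall>\<^sub>F t in nhds 0. g (x + t *\<^sub>R axis j 1) = f (x + t *\<^sub>R axis j 1)"
    by eventually_elim simp
  have "((\<lambda>t. f (x + t *\<^sub>R axis j 1)) has_vector_derivative d) (at 0) \<longleftrightarrow>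
      ((\<lambda>t. g (x + t *\<^sub>R axis j 1)) has_vector_derivative d) (at 0)" for d
    unfolding has_vector_derivative_def
    by (rule iffI) (erule has_derivative_eventually_cong[OF ev] has_derivative_eventually_cong[OF ev'])+
  then show ?thesis by (simp add: partial_deriv_def vector_derivative_def)
qed

abbreviation hessian :: "'l \<Rightarrow> 'l \<Rightarrow> (real^'l \<Rightarrow> 'b::real_normed_vector) \<Rightarrow> real^'l \<Rightarrow> 'b" where
  "hessian i j f \<equiv> partial_deriv i (partial_deriv j f)"

lemma hessian_cong:
  assumes "\<forall>\<^sub>F y in nhds x. f y = g y"
  shows "hessian i j f x = hessian i j g x"
proof (rule partial_deriv_cong)
  have "\<forall>\<^sub>F y in nhds x. \<forall>\<^sub>F z in nhds y. f z = g z"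
    using assms by (simp add: eventually_eventually)
  then show "\<forall>\<^sub>F y in nhds x. partial_deriv j f y = partial_deriv j g y"
    by eventually_elim (rule partial_deriv_cong)
qed

lemma twice_diff_at_differentiable:
  assumes "twice_diff_at f x"
  shows "\<forall>\<^sub>F y in nhds x. f differentiable (at y)" "f differentiable (at x)"
proof -
  from assms show "\<forall>\<^sub>F y in nhds x. f differentiable (at y)"
    by (rule twice_diff_atE) (auto elim: eventually_mono intro: differentiableI)
  then show "f differentiable (at x)" by (rule eventually_nhds_x_imp_x)
qed

text \<open>Evaluation at a basis vector is bounded linear in the derivative operator. This is what
  lets the first-order rules be applied to an inner partial derivative.\<close>

lemma twice_diff_at_partial_deriv:
  assumes "twice_diff_at f x"
  shows "partial_deriv j f differentiable (at x)"
proof -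
  obtain f' where f': "\<forall>\<^sub>F y in nhds x. (f has_derivative blinfun_apply (f' y)) (at y)"
    "f' differentiable (at x)" using assms by (rule twice_diff_atE)
  have ev: "\<forall>\<^sub>F y in nhds x. blinfun_apply (f' y) (axis j 1) = partial_deriv j f y"
    using f'(1) by eventually_elim (simp add: partial_deriv_eqI)
  have "(\<lambda>y. blinfun_apply (f' y) (axis j 1)) differentiable (at x)"
    using f'(2) by (rule differentiable_linear[OF blinfun.bounded_linear_left])
  then obtain D where "((\<lambda>y. blinfun_apply (f' y) (axis j 1)) has_derivative D) (at x)"
    unfolding differentiable_def ..
  from differentiableI[OF has_derivative_eventually_cong[OF ev this]] show ?thesis .
qed

section \<open>Rules of first order\<close>

lemma partial_deriv_const [simp]: "partial_deriv j (\<lambda>y. c) x = 0"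
  by (rule partial_deriv_eqI[where D="\<lambda>_. 0"]) simp

lemma partial_deriv_linear:
  assumes "bounded_linear h" "f differentiable (at x)"
  shows "partial_deriv j (\<lambda>y. h (f y)) x = h (partial_deriv j f x)"
proof -
  obtain D where D: "(f has_derivative D) (at x)" using assms(2) unfolding differentiable_def ..
  show ?thesis
    using partial_deriv_eqI[OF bounded_linear.has_derivative[OF assms(1) D]] partial_deriv_eqI[OF D] by simp
qed

lemma partial_deriv_bilinear:
  assumes "bounded_bilinear pr" "f differentiable (at x)" "g differentiable (at x)"
  shows "partial_deriv j (\<lambda>y. pr (f y) (g y)) x = pr (f x) (partial_deriv j g x) + pr (partial_deriv j f x) (g x)"
proof -
  obtain D E where D: "(f has_derivative D) (at x)" and E: "(g has_derivative E) (at x)"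
    using assms(2,3) unfolding differentiable_def by blast
  show ?thesis
    using partial_deriv_eqI[OF bounded_bilinear.FDERIV[OF assms(1) D E]] partial_deriv_eqI[OF D] partial_deriv_eqI[OF E]
    by simp
qed

lemma partial_deriv_add:
  assumes "f differentiable (at x)" "g differentiable (at x)"
  shows "partial_deriv j (\<lambda>y. f y + g y) x = partial_deriv j f x + partial_deriv j g x"
proof -
  obtain D E where D: "(f has_derivative D) (at x)" and E: "(g has_derivative E) (at x)"
    using assms unfolding differentiable_def by blast
  show ?thesis
    using partial_deriv_eqI[OF has_derivative_add[OF D E]] partial_deriv_eqI[OF D] partial_deriv_eqI[OF E] by simp
qed

lemma partial_deriv_sum:
  assumes "\<And>k. k \<in> A \<Longrightarrow> f k differentiable (at x)"
  shows "partial_deriv j (\<lambda>y. \<Sum>k\<in>A. f k y) x = (\<Sum>k\<in>A. partial_deriv j (f k) x)"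
proof -
  have "\<exists>D. \<forall>k\<in>A. (f k has_derivative D k) (at x)"
    using assms unfolding differentiable_def by (intro bchoice) blast
  then obtain D where D: "\<And>k. k \<in> A \<Longrightarrow> (f k has_derivative D k) (at x)" by blast
  show ?thesis
    using partial_deriv_eqI[OF has_derivative_sum[of A f D "at x"]] D partial_deriv_eqI[OF D] by simp
qed

lemma partial_deriv_chain:
  fixes f :: "real^'l \<Rightarrow> real"
  assumes "f differentiable (at x)" "(G has_field_derivative G') (at (f x))"
  shows "partial_deriv j (\<lambda>y. G (f y)) x = G' * partial_deriv j f x"
proof -
  obtain D where D: "(f has_derivative D) (at x)" using assms(1) unfolding differentiable_def ..
  show ?thesis
    using partial_deriv_eqI[OF diff_chain_at[OF D assms(2)[unfolded has_field_derivative_def]]]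
      partial_deriv_eqI[OF D] by (simp add: o_def)
qed

lemma partial_deriv_shift: "partial_deriv j (\<lambda>e. f (x + e)) y = partial_deriv j f (x + y)"
  by (simp add: partial_deriv_def add.assoc)

section \<open>Rules of second order\<close>

lemma hessian_shift: "hessian i j (\<lambda>e. f (x + e)) y = hessian i j f (x + y)"
proof -
  have "partial_deriv j (\<lambda>e. f (x + e)) = (\<lambda>e. partial_deriv j f (x + e))"
    by (rule ext) (rule partial_deriv_shift)
  then show ?thesis by (simp add: partial_deriv_shift)
qed

text \<open>The first-order rule holds on a whole neighbourhood, so
  \<open>partial_deriv_cong\<close> can rewrite the inner derivative before the outer one is taken.
  The product, sum and linear rules follow the same pattern.\<close>

lemma hessian_chain:
  fixes f :: "real^'l \<Rightarrow> real"
  assumes f: "twice_diff_at f x"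
    and G: "\<forall>\<^sub>F v in nhds (f x). (G has_field_derivative G' v) (at v)"
    and G': "(G' has_field_derivative G'') (at (f x))"
  shows "hessian i j (\<lambda>y. G (f y)) x =
    G'' * partial_deriv i f x * partial_deriv j f x + G' (f x) * hessian i j f x"
proof -
  have ev: "\<forall>\<^sub>F y in nhds x. (G has_field_derivative G' (f y)) (at (f y))"
    using twice_diff_at_imp_isCont[OF f] G by (rule eventually_nhds_compose)
  have "\<forall>\<^sub>F y in nhds x. partial_deriv j (\<lambda>y. G (f y)) y = G' (f y) * partial_deriv j f y"
    using twice_diff_at_differentiable(1)[OF f] ev by eventually_elim (rule partial_deriv_chain)
  then have "hessian i j (\<lambda>y. G (f y)) x = partial_deriv i (\<lambda>y. G' (f y) * partial_deriv j f y) x"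
    by (rule partial_deriv_cong)
  also have "\<dots> = G' (f x) * hessian i j f x + partial_deriv i (\<lambda>y. G' (f y)) x * partial_deriv j f x"
  proof (rule partial_deriv_bilinear[OF bounded_bilinear_mult])
    show "(\<lambda>y. G' (f y)) differentiable (at x)"
      using twice_diff_at_differentiable(2)[OF f] G' differentiable_chain_at[of f x G']
      by (auto simp: o_def has_field_derivative_def intro: differentiableI)
  qed (rule twice_diff_at_partial_deriv[OF f])
  also have "partial_deriv i (\<lambda>y. G' (f y)) x = G'' * partial_deriv i f x"
    using twice_diff_at_differentiable(2)[OF f] G' by (rule partial_deriv_chain)
  finally show ?thesis by simp
qed

lemma hessian_mult:
  fixes f g :: "real^'l \<Rightarrow> real"
  assumes f: "twice_diff_at f x" and g: "twice_diff_at g x"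
  shows "hessian i j (\<lambda>y. f y * g y) x = f x * hessian i j g x + partial_deriv i f x * partial_deriv j g x
    + partial_deriv j f x * partial_deriv i g x + hessian i j f x * g x"
proof -
  note dm = partial_deriv_bilinear[OF bounded_bilinear_mult]
  note fd = twice_diff_at_differentiable[OF f] and gd = twice_diff_at_differentiable[OF g]
  note fp = twice_diff_at_partial_deriv[OF f, of j] and gp = twice_diff_at_partial_deriv[OF g, of j]
  have "\<forall>\<^sub>F y in nhds x. partial_deriv j (\<lambda>y. f y * g y) y =
      f y * partial_deriv j g y + partial_deriv j f y * g y"
    using fd(1) gd(1) by eventually_elim (simp add: dm)
  then have "hessian i j (\<lambda>y. f y * g y) x =
      partial_deriv i (\<lambda>y. f y * partial_deriv j g y + partial_deriv j f y * g y) x"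
    by (rule partial_deriv_cong)
  also have "\<dots> = partial_deriv i (\<lambda>y. f y * partial_deriv j g y) x + partial_deriv i (\<lambda>y. partial_deriv j f y * g y) x"
    using fd(2) gd(2) fp gp by (intro partial_deriv_add differentiable_bilinear[OF bounded_bilinear_mult])
  finally show ?thesis using fd(2) gd(2) fp gp by (simp add: dm)
qed

lemma hessian_linear:
  assumes "bounded_linear h" "twice_diff_at f x"
  shows "hessian i j (\<lambda>y. h (f y)) x = h (hessian i j f x)"
proof -
  have "\<forall>\<^sub>F y in nhds x. partial_deriv j (\<lambda>y. h (f y)) y = h (partial_deriv j f y)"
    using twice_diff_at_differentiable(1)[OF assms(2)]
    by eventually_elim (rule partial_deriv_linear[OF assms(1)])
  then have "hessian i j (\<lambda>y. h (f y)) x = partial_deriv i (\<lambda>y. h (partial_deriv j f y)) x"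
    by (rule partial_deriv_cong)
  also have "\<dots> = h (hessian i j f x)"
    using assms(1) twice_diff_at_partial_deriv[OF assms(2)] by (rule partial_deriv_linear)
  finally show ?thesis .
qed

lemma hessian_sum:
  assumes "\<And>k. k \<in> A \<Longrightarrow> twice_diff_at (f k) x" "finite A"
  shows "hessian i j (\<lambda>y. \<Sum>k\<in>A. f k y) x = (\<Sum>k\<in>A. hessian i j (f k) x)"
proof -
  have "\<forall>\<^sub>F y in nhds x. \<forall>k\<in>A. f k differentiable (at y)"
    using assms(2) twice_diff_at_differentiable(1)[OF assms(1)] by (intro eventually_ball_finite) auto
  then have "\<forall>\<^sub>F y in nhds x. partial_deriv j (\<lambda>y. \<Sum>k\<in>A. f k y) y = (\<Sum>k\<in>A. partial_deriv j (f k) y)"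
    by eventually_elim (auto intro: partial_deriv_sum)
  then have "hessian i j (\<lambda>y. \<Sum>k\<in>A. f k y) x = partial_deriv i (\<lambda>y. \<Sum>k\<in>A. partial_deriv j (f k) y) x"
    by (rule partial_deriv_cong)
  also have "\<dots> = (\<Sum>k\<in>A. hessian i j (f k) x)"
    by (rule partial_deriv_sum[OF twice_diff_at_partial_deriv[OF assms(1)]])
  finally show ?thesis .
qed

lemma hessian_add:
  assumes f: "twice_diff_at f x" and g: "twice_diff_at g x"
  shows "hessian i j (\<lambda>y. f y + g y) x = hessian i j f x + hessian i j g x"
proof -
  have "\<forall>\<^sub>F y in nhds x. partial_deriv j (\<lambda>y. f y + g y) y = partial_deriv j f y + partial_deriv j g y"
    using twice_diff_at_differentiable(1)[OF f] twice_diff_at_differentiable(1)[OF g]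
    by eventually_elim (rule partial_deriv_add)
  then have "hessian i j (\<lambda>y. f y + g y) x = partial_deriv i (\<lambda>y. partial_deriv j f y + partial_deriv j g y) x"
    by (rule partial_deriv_cong)
  also have "\<dots> = hessian i j f x + hessian i j g x"
    by (rule partial_deriv_add[OF twice_diff_at_partial_deriv[OF f] twice_diff_at_partial_deriv[OF g]])
  finally show ?thesis .
qed

lemma hessian_cmult:
  assumes "twice_diff_at f x"
  shows "hessian i j (\<lambda>y. c * f y :: real) x = c * hessian i j f x"
  using assms by (rule hessian_linear[OF bounded_linear_mult_right])

lemma hessian_const: "hessian i j (\<lambda>y. c) x = 0"
proof -
  have "partial_deriv j (\<lambda>y. c) = (\<lambda>y. 0)" by (rule ext) simp
  then show ?thesis by simp
qed

lemma eventually_pos_nhds: "(u::real) > 0 \<Longrightarrow> \<forall>\<^sub>F v in nhds u. v > 0"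
  using eventually_nhds_in_open[of "{0<..}" u] by simp

lemma hessian_powr:
  fixes f :: "real^'l \<Rightarrow> real"
  assumes f: "twice_diff_at f x" "f x > 0"
  shows "hessian i j (\<lambda>y. f y powr s) x =
    s * (s - 1) * f x powr (s - 2) * partial_deriv i f x * partial_deriv j f x
    + s * f x powr (s - 1) * hessian i j f x"
proof -
  have "\<forall>\<^sub>F v in nhds (f x). ((\<lambda>v. v powr s) has_field_derivative s * v powr (s - 1)) (at v)"
    using eventually_pos_nhds[OF f(2)] by eventually_elim (rule has_real_derivative_powr)
  moreover have "((\<lambda>v. s * v powr (s - 1)) has_field_derivative s * ((s - 1) * f x powr (s - 1 - 1))) (at (f x))"
    by (intro DERIV_cmult has_real_derivative_powr f)
  ultimately show ?thesis by (subst hessian_chain[OF f(1)]) (auto simp: algebra_simps)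
qed

lemma hessian_ln:
  fixes f :: "real^'l \<Rightarrow> real"
  assumes f: "twice_diff_at f x" "f x > 0"
  shows "hessian i j (\<lambda>y. ln (f y)) x =
    hessian i j f x / f x - partial_deriv i f x * partial_deriv j f x / (f x)\<^sup>2"
proof -
  have "\<forall>\<^sub>F v in nhds (f x). (ln has_field_derivative inverse v) (at v)"
    using eventually_pos_nhds[OF f(2)] by eventually_elim (rule DERIV_ln)
  moreover have "(inverse has_field_derivative - (inverse (f x) ^ Suc (Suc 0))) (at (f x))"
    using f by (intro DERIV_inverse) auto
  ultimately show ?thesis
    by (subst hessian_chain[OF f(1)]) (auto simp: divide_simps power2_eq_square)
qed

section \<open>Block structure of classical-quantum states\<close>

text \<open>The operator \<open>|v\<rangle> \<otimes> 1\<close> from the second tensor factor to the product space.\<close>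

definition ket_tensor :: "complex^'x \<Rightarrow> complex^'a^('x \<times> 'a)" where
  "ket_tensor v = (\<chi> r b. if snd r = b then v $ fst r else 0)"

text \<open>For an orthonormal \<open>ket\<close> the maps \<open>ket_tensor (ket x)\<close> are
  isometries with mutually orthogonal ranges, so this is a direct sum of the blocks, written in the
  basis \<open>ket\<close> and not in the coordinate basis.\<close>

definition cq_block :: "('x::finite \<Rightarrow> complex^'x) \<Rightarrow> ('x \<Rightarrow> complex^'a^'a) \<Rightarrow> complex^('x \<times> 'a)^('x \<times> 'a)" where
  "cq_block ket B = (\<Sum>x\<in>UNIV. ket_tensor (ket x) ** B x ** dagger (ket_tensor (ket x)))"

lemma ket_tensor_mult_nth: "(ket_tensor v ** B) $ r $ c = v $ fst r * B $ snd r $ c"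
  by (simp add: matrix_matrix_mult_def ket_tensor_def if_distrib if_distribR cong: if_cong)

lemma kron_ketbra: "kron (ketbra v v) B = ket_tensor v ** B ** dagger (ket_tensor v)"
proof -
  have "(ket_tensor v ** B ** dagger (ket_tensor v)) $ r $ s = v $ fst r * B $ snd r $ snd s * cnj (v $ fst s)" for r s
    by (simp add: matrix_matrix_mult_def[of "ket_tensor v ** B"] ket_tensor_mult_nth)
      (simp add: ket_tensor_def if_distrib if_distribR cong: if_cong)
  then show ?thesis by (simp add: vec_eq_iff kron_def ketbra_def)
qed

lemma cq_state_eq_cq_block: "cq_state ket q \<tau> = cq_block ket (\<lambda>x. q x *\<^sub>R \<tau> x)"
  by (simp add: cq_state_def cq_block_def kron_ketbra matrix_mult_simps)

lemma ket_tensor_inner: "dagger (ket_tensor v) ** ket_tensor w = (mat (cinner v w) :: complex^'a^'a)"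
proof -
  have "(dagger (ket_tensor v) ** ket_tensor w) $ b $ c = (if b = c then cinner v w else 0)" for b c :: 'a
  proof -
    have "(dagger (ket_tensor v) ** ket_tensor w) $ b $ c = (\<Sum>r\<in>UNIV \<times> UNIV. case r of (i, a) \<Rightarrow>
        (if a = b then cnj (v $ i) else 0) * (if a = c then w $ i else 0))"
      by (simp add: matrix_matrix_mult_def ket_tensor_def case_prod_beta if_distrib[of cnj] cong: if_cong)
    also have "\<dots> = (\<Sum>i\<in>UNIV. \<Sum>a\<in>UNIV. (if a = b then cnj (v $ i) else 0) * (if a = c then w $ i else 0))"
      by (rule sum.cartesian_product[symmetric])
    also have "\<dots> = (if b = c then cinner v w else 0)"
      by (simp add: cinner_def if_distribR if_distrib[of "\<lambda>z. z * _"] cong: if_cong)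
    finally show ?thesis .
  qed
  then show ?thesis by (simp add: vec_eq_iff mat_def)
qed

context
  fixes ket :: "'x::finite \<Rightarrow> complex^'x"
  assumes ket: "orthonormal_basis ket"
begin

lemma ket_tensor_ket: "dagger (ket_tensor (ket x)) ** ket_tensor (ket y) = (if x = y then mat 1 else (0 :: complex^'a^'a))"
  using ket by (simp add: ket_tensor_inner orthonormal_basis_def)

lemma ket_tensor_ket_cancel: "dagger (ket_tensor (ket x)) ** (ket_tensor (ket y) ** B) = (if x = y then B else (0 :: complex^'b^'a))"
  by (simp add: matrix_mul_assoc ket_tensor_ket matrix_mult_simps)

lemma cq_block_mult: "cq_block ket B ** cq_block ket C = cq_block ket (\<lambda>x. B x ** C x)"
  unfolding cq_block_def
  by (simp add: bounded_bilinear.sum_left[OF bounded_bilinear_matrix_mult]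
    bounded_bilinear.sum_right[OF bounded_bilinear_matrix_mult] matrix_mul_assoc[symmetric] ket_tensor_ket_cancel
    matrix_mult_simps if_distrib[of "\<lambda>z. _ ** z"] cong: if_cong)

lemma trace_cq_block: "trace (cq_block ket B) = (\<Sum>x\<in>UNIV. trace (B x))"
proof -
  have "trace (ket_tensor (ket x) ** B x ** dagger (ket_tensor (ket x))) = trace (B x)" for x
    by (subst trace_mult_commute) (simp add: ket_tensor_ket_cancel)
  then show ?thesis
    by (simp add: cq_block_def linear_sum[OF bounded_linear.linear[OF bounded_linear_trace]])
qed

lemma cq_block_block: "dagger (ket_tensor (ket x)) ** cq_block ket B ** ket_tensor (ket x) = B x"
  unfolding cq_block_def
  by (simp add: bounded_bilinear.sum_left[OF bounded_bilinear_matrix_mult]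
    bounded_bilinear.sum_right[OF bounded_bilinear_matrix_mult] matrix_mul_assoc[symmetric] ket_tensor_ket_cancel
    ket_tensor_ket matrix_mult_simps if_distrib[of "\<lambda>z. _ ** z"] cong: if_cong)

text \<open>Column (x, a) of \<open>W\<close> is the a-th eigenvector of block x, embedded by
  \<open>ket_tensor (ket x)\<close>. Orthogonality between different x comes from the kets, and
  within one x from \<open>U x\<close>.\<close>

lemma cq_block_unitary_diag:
  fixes U :: "'x \<Rightarrow> complex^'a^'a"
  assumes U: "\<And>x. unitary (U x)"
  defines "W \<equiv> (\<chi> r c. (ket_tensor (ket (fst c)) ** U (fst c)) $ r $ snd c)"
  shows "unitary W"
    and "cq_block ket (\<lambda>x. U x ** diag_mat (d x) ** dagger (U x)) =
      W ** diag_mat (\<lambda>c. d (fst c) (snd c)) ** dagger W"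
proof -
  have "(dagger W ** W) $ c $ e =
      (dagger (ket_tensor (ket (fst c)) ** U (fst c)) ** (ket_tensor (ket (fst e)) ** U (fst e))) $ snd c $ snd e" for c e
    by (simp add: W_def matrix_matrix_mult_def[of "dagger _" "\<chi> r c. _ r c"] matrix_matrix_mult_def[of "dagger _" "ket_tensor _ ** _"])
  also have "\<dots> c e = (mat 1 :: complex^('x \<times> 'a)^('x \<times> 'a)) $ c $ e" for c e
    by (auto simp: dagger_mult matrix_mul_assoc[symmetric] ket_tensor_ket_cancel unitary_cancel[OF U]
        matrix_mult_simps mat_def prod_eq_iff)
  finally have "dagger W ** W = mat 1" by (simp add: vec_eq_iff)
  then show "unitary W" by (rule unitaryI)
  have "(W ** diag_mat (\<lambda>c. d (fst c) (snd c)) ** dagger W) $ r $ s =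
      cq_block ket (\<lambda>x. U x ** diag_mat (d x) ** dagger (U x)) $ r $ s" for r s
  proof -
    have "(W ** diag_mat (\<lambda>c. d (fst c) (snd c)) ** dagger W) $ r $ s =
      (\<Sum>c\<in>UNIV \<times> UNIV. case c of (x, a) \<Rightarrow>
        (ket_tensor (ket x) ** U x ** diag_mat (d x)) $ r $ a * dagger (ket_tensor (ket x) ** U x) $ a $ s)"
      by (simp add: matrix_matrix_mult_def[of "W ** _"] case_prod_beta) (simp add: W_def)
    also have "\<dots> = (\<Sum>x\<in>UNIV. \<Sum>a\<in>UNIV.
        (ket_tensor (ket x) ** U x ** diag_mat (d x)) $ r $ a * dagger (ket_tensor (ket x) ** U x) $ a $ s)"
      by (rule sum.cartesian_product[symmetric])
    also have "\<dots> = (\<Sum>x\<in>UNIV. (ket_tensor (ket x) ** U x ** diag_mat (d x) ** dagger (ket_tensor (ket x) ** U x)) $ r $ s)"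
      by (simp add: matrix_matrix_mult_def[of "ket_tensor _ ** U _ ** _"])
    also have "\<dots> = cq_block ket (\<lambda>x. U x ** diag_mat (d x) ** dagger (U x)) $ r $ s"
      by (simp add: cq_block_def dagger_mult matrix_mul_assoc)
    finally show ?thesis .
  qed
  then show "cq_block ket (\<lambda>x. U x ** diag_mat (d x) ** dagger (U x)) =
      W ** diag_mat (\<lambda>c. d (fst c) (snd c)) ** dagger W" by (simp add: vec_eq_iff)
qed

lemma mat_fun_cq_block:
  assumes "\<And>x. hermitian (B x)"
  shows "mat_fun f (cq_block ket B) = cq_block ket (\<lambda>x. mat_fun f (B x))"
proof -
  have "\<exists>U d. unitary U \<and> B x = U ** diag_mat d ** dagger U" for x
    using hermitian_spectral[OF assms] by metis
  then obtain U d where U: "\<And>x. unitary (U x)" and B: "\<And>x. B x = U x ** diag_mat (d x) ** dagger (U x)"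
    by metis
  show ?thesis
    unfolding B mat_fun_unitary[OF U] cq_block_unitary_diag(2)[OF U]
    by (subst mat_fun_unitary[OF cq_block_unitary_diag(1)[OF U]]) (simp add: o_def)
qed

text \<open>A block is the compression of the whole matrix by an isometry, which sends nonzero
  vectors to nonzero vectors.\<close>

lemma pos_def_cq_block_block:
  assumes "pos_def (cq_block ket B)"
  shows "pos_def (B x)"
proof -
  let ?V = "ket_tensor (ket x)"
  have "dagger (B x) = dagger (dagger ?V ** cq_block ket B ** ?V)" by (simp add: cq_block_block)
  also have "\<dots> = dagger ?V ** cq_block ket B ** ?V"
    using assms by (simp add: dagger_mult matrix_mul_assoc pos_def_def hermitian_def)
  also have "\<dots> = B x" by (rule cq_block_block)
  finally have "hermitian (B x)" by (simp add: hermitian_def)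
  moreover have "0 < Re (cinner v (B x *v v))" if "v \<noteq> 0" for v
  proof -
    have "dagger ?V *v (?V *v v) = v" by (simp add: matrix_vector_mul_assoc ket_tensor_ket)
    then have "?V *v v \<noteq> 0" using that by auto
    then have "0 < Re (cinner (?V *v v) (cq_block ket B *v (?V *v v)))" using assms by (simp add: pos_def_def)
    also have "cinner (?V *v v) (cq_block ket B *v (?V *v v)) = cinner v (dagger ?V *v (cq_block ket B *v (?V *v v)))"
      by (simp add: cinner_matrix[of v])
    also have "\<dots> = cinner v (B x *v v)"
      by (simp only: matrix_vector_mul_assoc matrix_mul_assoc cq_block_block)
    finally show ?thesis .
  qed
  ultimately show ?thesis by (simp add: pos_def_def)
qed

end

text \<open>Completeness of the basis comes out of the functional calculus: the constant function 1,
  applied as a whole, gives the identity, and applied block by block it gives the identity in every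
  block.\<close>

lemma cq_block_mat_1:
  assumes "orthonormal_basis ket"
  shows "cq_block ket (\<lambda>x. mat 1) = (mat 1 :: complex^('x::finite \<times> 'a::finite)^('x \<times> 'a))"
proof -
  have h: "hermitian (mat 1 :: complex^'n^'n)" by (simp add: hermitian_def vec_eq_iff mat_def)
  have "hermitian (cq_block ket (\<lambda>x. mat 1 :: complex^'a^'a))"
    by (simp add: hermitian_def cq_block_def dagger_mult dagger_sum)
  from mat_fun_const_1[OF this] show ?thesis
    unfolding mat_fun_cq_block[OF assms h] mat_fun_const_1[OF h] .
qed

section \<open>Splitting of the trace functional and of the relative entropy\<close>

lemma pos_def_scaleR:
  assumes "c > 0" "pos_def A" shows "pos_def (c *\<^sub>R A)"
proof -
  obtain U d where "unitary U" "A = U ** diag_mat d ** dagger U" "\<And>i. d i > 0"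
    using pos_def_spectral[OF assms(2)] by metis
  then show ?thesis using assms(1) by (simp add: unitary_diag_scaleR pos_def_unitary_diag)
qed

lemma pos_def_sandwich:
  assumes S: "pos_def S" and A: "pos_def A"
  shows "pos_def (S ** A ** S)"
  unfolding pos_def_def
proof (intro conjI allI impI)
  have [simp]: "dagger S = S" "dagger A = A" using S A by (simp_all add: pos_def_def hermitian_def)
  show "hermitian (S ** A ** S)" by (simp add: hermitian_def dagger_mult matrix_mul_assoc)
  fix v :: "complex^'a" assume "v \<noteq> 0"
  then have "0 < Re (cinner v (S *v v))" using S by (simp add: pos_def_def)
  then have "S *v v \<noteq> 0" by (auto simp: cinner_def)
  then have "0 < Re (cinner (S *v v) (A *v (S *v v)))" using A by (simp add: pos_def_def)
  also have "\<dots> = Re (cinner v (S ** A ** S *v v))"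
    by (simp add: cinner_matrix[of v S] matrix_vector_mul_assoc[symmetric])
  finally show "0 < Re (cinner v (S ** A ** S *v v))" .
qed

lemma pos_def_mat_powr: "pos_def A \<Longrightarrow> pos_def (mat_powr A s)"
  unfolding mat_powr_def by (rule pos_def_mat_fun) auto

lemma mat_powr_scaleR:
  assumes "c > 0" "pos_def A"
  shows "mat_powr (c *\<^sub>R A) s = (c powr s) *\<^sub>R mat_powr A s"
proof -
  have "mat_fun (\<lambda>t. (c * t) powr s) A = mat_fun (\<lambda>t. c powr s * t powr s) A"
    by (rule mat_fun_cong_pos[OF assms(2)]) (use assms(1) in \<open>simp add: powr_mult\<close>)
  then show ?thesis
    by (simp add: mat_powr_def mat_fun_scaleR scaleR_mat_fun pos_def_imp_hermitian assms(2))
qed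

lemma mat_ln_scaleR:
  assumes "c > 0" "pos_def A"
  shows "mat_ln (c *\<^sub>R A) = (ln c) *\<^sub>R mat 1 + mat_ln A"
proof -
  obtain U d where U: "unitary U" and A: "A = U ** diag_mat d ** dagger U" and d: "\<And>i. d i > 0"
    using pos_def_spectral[OF assms(2)] by metis
  have "diag_mat (\<lambda>i. ln (c * d i)) = ln c *\<^sub>R mat 1 + diag_mat (\<lambda>i. ln (d i))"
  proof -
    have "ln (c * d i) = ln c + ln (d i)" for i using assms(1) d[of i] by (simp add: ln_mult_pos)
    then show ?thesis
      by (simp add: vec_eq_iff diag_mat_def mat_def scaleR_conv_of_real[where 'a=complex])
  qed
  then show ?thesis
    by (simp add: mat_ln_def A unitary_diag_scaleR mat_fun_unitary[OF U] o_def matrix_mult_simps unitary_cancel[OF U])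
qed

definition alpha_z_trace :: "real \<Rightarrow> real \<Rightarrow> complex^'n^'n \<Rightarrow> complex^'n^'n \<Rightarrow> real" where
  "alpha_z_trace \<alpha> z \<rho> \<sigma> = Re (trace (mat_powr
       (mat_powr \<sigma> ((1 - \<alpha>) / (2 * z)) ** mat_powr \<rho> (\<alpha> / z) ** mat_powr \<sigma> ((1 - \<alpha>) / (2 * z))) z))"

lemma alpha_z_divergence_eq:
  "alpha_z_divergence \<alpha> z \<rho> \<sigma> = 1 / (\<alpha> - 1) * ln (alpha_z_trace \<alpha> z \<rho> \<sigma>)"
  by (simp add: alpha_z_divergence_def alpha_z_trace_def)

lemma alpha_z_trace_cq:
  assumes ket: "orthonormal_basis ket" and z: "z > 0"
    and p: "\<And>x. p x > 0" "\<And>x. q x > 0" and pd: "\<And>x. pos_def (\<tau> x)" "\<And>x. pos_def (\<sigma> x)"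
  shows "alpha_z_trace \<alpha> z (cq_state ket p \<tau>) (cq_state ket q \<sigma>) =
    (\<Sum>x\<in>UNIV. p x powr \<alpha> * (q x powr (1 - \<alpha>) * alpha_z_trace \<alpha> z (\<tau> x) (\<sigma> x)))"
proof -
  define s where "s = (1 - \<alpha>) / (2 * z)"
  have pr: "mat_powr (cq_block ket B) r = cq_block ket (\<lambda>x. mat_powr (B x) r)" if "\<And>x. pos_def (B x)" for B :: "_ \<Rightarrow> complex^'b^'b" and r
    unfolding mat_powr_def by (rule mat_fun_cq_block[OF ket]) (use that in \<open>simp add: pos_def_imp_hermitian\<close>)
  define Y where "Y x = mat_powr (\<sigma> x) s ** mat_powr (\<tau> x) (\<alpha> / z) ** mat_powr (\<sigma> x) s" for x
  \<comment> \<open>The scalar weight that the three powers extract from block x. Its z-th power is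
    p^\<alpha> q^(2 s z) with 2 s z = 1 - \<alpha>, so z disappears from the weights.\<close>
  define k where "k x = q x powr s * p x powr (\<alpha> / z) * q x powr s" for x
  have k: "k x > 0" for x using p[of x] by (simp add: k_def)
  have Y: "pos_def (Y x)" for x unfolding Y_def by (intro pos_def_sandwich pos_def_mat_powr pd)
  have "mat_powr (cq_state ket q \<sigma>) s ** mat_powr (cq_state ket p \<tau>) (\<alpha> / z) ** mat_powr (cq_state ket q \<sigma>) s
     = cq_block ket (\<lambda>x. k x *\<^sub>R Y x)"
    unfolding cq_state_eq_cq_block
    by (simp add: pr pos_def_scaleR p pd cq_block_mult[OF ket] mat_powr_scaleR matrix_mult_simps Y_def k_def mult_ac)
  then have "alpha_z_trace \<alpha> z (cq_state ket p \<tau>) (cq_state ket q \<sigma>) =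
     Re (trace (cq_block ket (\<lambda>x. k x powr z *\<^sub>R mat_powr (Y x) z)))"
    by (simp add: alpha_z_trace_def s_def[symmetric] pr pos_def_scaleR k Y mat_powr_scaleR)
  also have "\<dots> = (\<Sum>x\<in>UNIV. k x powr z * alpha_z_trace \<alpha> z (\<tau> x) (\<sigma> x))"
    by (simp add: trace_cq_block[OF ket] trace_scaleR alpha_z_trace_def s_def[symmetric] Y_def)
  also have "\<dots> = (\<Sum>x\<in>UNIV. p x powr \<alpha> * (q x powr (1 - \<alpha>) * alpha_z_trace \<alpha> z (\<tau> x) (\<sigma> x)))"
  proof (rule sum.cong[OF refl])
    fix x
    have "k x powr z = q x powr (s * z + s * z) * p x powr \<alpha>"
      unfolding k_def powr_add using p[of x] z by (simp add: powr_mult powr_powr)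
    also have "s * z + s * z = 1 - \<alpha>" using z by (simp add: s_def field_simps)
    finally show "k x powr z * alpha_z_trace \<alpha> z (\<tau> x) (\<sigma> x) =
       p x powr \<alpha> * (q x powr (1 - \<alpha>) * alpha_z_trace \<alpha> z (\<tau> x) (\<sigma> x))" by simp
  qed
  finally show ?thesis .
qed

text \<open>The logarithm turns the weights into multiples of the identity within each block, and
  the unit trace of \<open>\<tau> x\<close> reduces these to the classical relative entropy.\<close>

lemma relative_entropy_cq:
  assumes ket: "orthonormal_basis ket"
    and p: "\<And>x. p x > 0" "\<And>x. q x > 0" and pd: "\<And>x. pos_def (\<tau> x)" "\<And>x. pos_def (\<sigma> x)"
    and tr: "\<And>x. trace (\<tau> x) = 1"
  shows "relative_entropy (cq_state ket p \<tau>) (cq_state ket q \<sigma>) =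
    (\<Sum>x\<in>UNIV. p x * (ln (p x) - ln (q x)) + p x * relative_entropy (\<tau> x) (\<sigma> x))"
proof -
  have ln: "mat_ln (cq_block ket B) = cq_block ket (\<lambda>x. mat_ln (B x))" if "\<And>x. pos_def (B x)" for B :: "_ \<Rightarrow> complex^'b^'b"
    unfolding mat_ln_def by (rule mat_fun_cq_block[OF ket]) (use that in \<open>simp add: pos_def_imp_hermitian\<close>)
  have diff: "cq_block ket B - cq_block ket C = cq_block ket (\<lambda>x. B x - C x)" for B C :: "_ \<Rightarrow> complex^'b^'b"
    by (simp add: cq_block_def matrix_mult_simps sum_subtractf)
  have "mat_ln (cq_state ket p \<tau>) - mat_ln (cq_state ket q \<sigma>) =
     cq_block ket (\<lambda>x. (ln (p x) - ln (q x)) *\<^sub>R mat 1 + (mat_ln (\<tau> x) - mat_ln (\<sigma> x)))"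
    unfolding cq_state_eq_cq_block
    by (simp add: ln pos_def_scaleR p pd mat_ln_scaleR diff algebra_simps)
  then have "relative_entropy (cq_state ket p \<tau>) (cq_state ket q \<sigma>) =
    Re (trace (cq_block ket (\<lambda>x. (p x *\<^sub>R \<tau> x) ** ((ln (p x) - ln (q x)) *\<^sub>R mat 1 + (mat_ln (\<tau> x) - mat_ln (\<sigma> x))))))"
    by (simp only: relative_entropy_def cq_state_eq_cq_block cq_block_mult[OF ket])
  also have "\<dots> = (\<Sum>x\<in>UNIV. p x * (ln (p x) - ln (q x)) + p x * relative_entropy (\<tau> x) (\<sigma> x))"
    unfolding trace_cq_block[OF ket] Re_sum
    by (rule sum.cong[OF refl])
      (simp add: matrix_mult_simps trace_add trace_scaleR tr relative_entropy_def trace_sub algebra_simps)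
  finally show ?thesis .
qed

section \<open>Differentiability of the divergences\<close>

text \<open>All factors are functions of the same matrix, and the exponents combine to 1.\<close>

lemma alpha_z_trace_self:
  assumes "pos_def \<rho>" "z > 0"
  shows "alpha_z_trace \<alpha> z \<rho> \<rho> = Re (trace \<rho>)"
proof -
  have h: "hermitian \<rho>" using assms(1) by (rule pos_def_imp_hermitian)
  let ?g = "\<lambda>t. t powr ((1 - \<alpha>) / (2 * z)) * t powr (\<alpha> / z) * t powr ((1 - \<alpha>) / (2 * z))"
  have "mat_powr (mat_powr \<rho> ((1 - \<alpha>) / (2 * z)) ** mat_powr \<rho> (\<alpha> / z) ** mat_powr \<rho> ((1 - \<alpha>) / (2 * z))) z
     = mat_fun ((\<lambda>t. t powr z) \<circ> ?g) \<rho>"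
    by (simp only: mat_powr_def mat_fun_mult[OF h] mat_fun_compose[OF h])
  also have "\<dots> = mat_fun (\<lambda>t. t) \<rho>"
  proof (rule mat_fun_cong_pos[OF assms(1)])
    fix t :: real assume t: "t > 0"
    have e: "((1 - \<alpha>) / (2 * z) + \<alpha> / z + (1 - \<alpha>) / (2 * z)) * z = 1"
      using assms(2) by (simp add: field_simps)
    have "?g t = t powr ((1 - \<alpha>) / (2 * z) + \<alpha> / z + (1 - \<alpha>) / (2 * z))" by (simp only: powr_add)
    then have "((\<lambda>t. t powr z) \<circ> ?g) t = t powr (((1 - \<alpha>) / (2 * z) + \<alpha> / z + (1 - \<alpha>) / (2 * z)) * z)"
      by (simp only: o_def powr_powr)
    then show "((\<lambda>t. t powr z) \<circ> ?g) t = t" using t by (simp only: e powr_one)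
  qed
  finally show ?thesis by (simp add: alpha_z_trace_def mat_fun_ident[OF h])
qed

text \<open>The trace rule is used at two levels. For the outer power the test matrix is the
  identity; cyclicity then leaves the derivative \<open>Z\<close> of the inner power paired with a
  function of \<open>\<rho>\<close> alone, so the rule applies once more. The remaining powers of
  \<open>\<rho>\<close> cancel and the constants multiply to 2 z s = 1 - \<alpha>.\<close>

lemma alpha_z_trace_curve:
  fixes X :: "'e::real_normed_vector \<Rightarrow> complex^'n^'n"
  assumes z: "z > 0" and X: "twice_diff_at X t0"
    and herm: "\<forall>\<^sub>F t in nhds t0. hermitian (X t)" and pd: "pos_def (X t0)"
  shows twice_diff_at_alpha_z_trace: "twice_diff_at (\<lambda>t. alpha_z_trace \<alpha> z (X t0) (X t)) t0"
    and has_derivative_alpha_z_trace: "(X has_derivative X') (at t0) \<Longrightarrow>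
      ((\<lambda>t. alpha_z_trace \<alpha> z (X t0) (X t)) has_derivative (\<lambda>h. (1 - \<alpha>) * Re (trace (X' h)))) (at t0)"
proof -
  define s where "s = (1 - \<alpha>) / (2 * z)"
  define \<rho> where "\<rho> = X t0"
  have h: "hermitian \<rho>" using pd by (simp add: \<rho>_def pos_def_def)
  define A where "A = mat_powr \<rho> (\<alpha> / z)"
  define S where "S = (\<lambda>t. mat_powr (X t) s)"
  define Y where "Y = (\<lambda>t. S t ** A ** S t)"
  have Q: "alpha_z_trace \<alpha> z (X t0) (X t) = Re (trace (mat_powr (Y t) z))" for t
    by (simp add: alpha_z_trace_def Y_def S_def A_def s_def \<rho>_def)
  note bm = bounded_bilinear_matrix_mult
  have S: "twice_diff_at S t0"
    unfolding S_def mat_powr_def by (rule twice_diff_at_mat_fun[OF disc_analytic_powr X herm pd])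
  have Y: "twice_diff_at Y t0"
    unfolding Y_def by (intro twice_diff_at_bilinear[OF bm] S twice_diff_at_const)
  have hA: "dagger A = A" using hermitian_mat_fun[OF h] by (simp add: A_def mat_powr_def hermitian_def)
  have hermY: "\<forall>\<^sub>F t in nhds t0. hermitian (Y t)"
    using herm
  proof eventually_elim
    case (elim t)
    then have "dagger (S t) = S t" using hermitian_mat_fun by (simp add: S_def mat_powr_def hermitian_def)
    then show ?case by (simp add: Y_def hermitian_def dagger_mult hA matrix_mul_assoc)
  qed
  have pdY: "pos_def (Y t0)" unfolding Y_def S_def A_def using pd by (intro pos_def_sandwich pos_def_mat_powr) (simp_all add: \<rho>_def)
  have bl: "bounded_linear (\<lambda>M. Re (trace M))"
    by (intro bounded_linear_compose[OF bounded_linear_Re bounded_linear_trace])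
  show "twice_diff_at (\<lambda>t. alpha_z_trace \<alpha> z (X t0) (X t)) t0"
    unfolding Q mat_powr_def
    by (intro twice_diff_at_linear_compose[OF bl] twice_diff_at_mat_fun[OF disc_analytic_powr Y hermY pdY])
  assume X': "(X has_derivative X') (at t0)"
  from trace_derivative_mat_fun[OF disc_analytic_powr[of s] X herm pd X' has_real_derivative_powr]
  obtain Z where Z: "(S has_derivative Z) (at t0)"
    and trZ: "\<And>B h. B ** \<rho> = \<rho> ** B \<Longrightarrow> trace (B ** Z h) = trace (B ** mat_fun (\<lambda>t. s * t powr (s - 1)) \<rho> ** X' h)"
    unfolding S_def mat_powr_def \<rho>_def by blast
  have "((\<lambda>t. S t ** A) has_derivative (\<lambda>h. Z h ** A)) (at t0)"
    by (rule bounded_linear.has_derivative[OF bounded_linear_matrix_mult_left Z])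
  from bounded_bilinear.FDERIV[OF bm this Z]
  have Y': "(Y has_derivative (\<lambda>h. S t0 ** A ** Z h + Z h ** A ** S t0)) (at t0)"
    unfolding Y_def .
  from trace_derivative_mat_fun[OF disc_analytic_powr[of z] Y hermY pdY Y' has_real_derivative_powr]
  obtain W where W: "((\<lambda>t. mat_powr (Y t) z) has_derivative W) (at t0)"
    and trW: "\<And>B h. B ** Y t0 = Y t0 ** B \<Longrightarrow> trace (B ** W h) =
      trace (B ** mat_fun (\<lambda>t. z * t powr (z - 1)) (Y t0) ** (S t0 ** A ** Z h + Z h ** A ** S t0))"
    unfolding mat_powr_def by blast
  define C where "C = mat_fun (\<lambda>t. z * t powr (z - 1)) (Y t0)"
  \<comment> \<open>The common value of C S A and A S C as functions of \<rho>: Y t0 is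
    \<rho>^(1/z), and 1 - 1/z + s + \<alpha>/z = 1 - s because 2 s = (1 - \<alpha>)/z.\<close>
  define g where "g = (\<lambda>t. z * t powr (1 - s))"
  let ?f = "\<lambda>t. t powr s * t powr (\<alpha> / z) * t powr s"
  have Y0: "Y t0 = mat_fun ?f \<rho>"
    by (simp only: Y_def S_def A_def mat_powr_def \<rho>_def[symmetric] mat_fun_mult[OF h])
  have e1: "t powr s * t powr (\<alpha> / z) * t powr s = t powr (1 / z)" for t :: real
  proof -
    have "s + \<alpha> / z + s = 1 / z" using z by (simp add: s_def field_simps)
    then show ?thesis by (simp only: powr_add[symmetric])
  qed
  have e2: "z * (t powr (1 / z)) powr (z - 1) * (t powr s * t powr (\<alpha> / z)) = g t" for t :: real
  proof -
    have "1 / z * (z - 1) + (s + \<alpha> / z) = 1 - s" using z by (simp add: s_def field_simps)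
    then show ?thesis by (simp only: g_def powr_powr powr_add[symmetric] mult.assoc)
  qed
  have C: "C = mat_fun (\<lambda>t. z * (t powr (1 / z)) powr (z - 1)) \<rho>"
    by (simp add: C_def Y0 mat_fun_compose[OF h] o_def e1)
  have CSA: "C ** (S t0 ** A) = mat_fun g \<rho>"
    by (simp only: C S_def A_def mat_powr_def \<rho>_def[symmetric] mat_fun_mult[OF h] e2)
  have ASC: "A ** S t0 ** C = mat_fun g \<rho>"
    unfolding C S_def A_def mat_powr_def \<rho>_def[symmetric] mat_fun_mult[OF h]
    by (rule arg_cong[where f="\<lambda>f. mat_fun f \<rho>"]) (auto simp: e2[symmetric] mult_ac)
  have trWh: "trace (W h) = (1 - \<alpha>) *\<^sub>R trace (X' h)" for h
  proof -
    \<comment> \<open>Admits g(\<rho>) as the test matrix in the rule for the inner power.\<close>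
    have comm: "mat_fun g \<rho> ** \<rho> = \<rho> ** mat_fun g \<rho>"
      using mat_fun_mult[OF h, of g "\<lambda>t. t"] mat_fun_mult[OF h, of "\<lambda>t. t" g]
      by (simp add: mat_fun_ident[OF h] mult.commute)
    have "trace (W h) = trace (C ** (S t0 ** A ** Z h + Z h ** A ** S t0))"
      using trW[of "mat 1" h] by (simp add: C_def)
    also have "\<dots> = trace (C ** (S t0 ** A) ** Z h) + trace (C ** (Z h ** (A ** S t0)))"
      by (simp add: matrix_mult_simps trace_add matrix_mul_assoc)
    also have "trace (C ** (Z h ** (A ** S t0))) = trace (A ** S t0 ** C ** Z h)"
      by (metis matrix_mul_assoc trace_mult_commute)
    finally have "trace (W h) = 2 *\<^sub>R trace (mat_fun g \<rho> ** Z h)"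
      unfolding CSA ASC by (simp add: scaleR_2)
    also have "trace (mat_fun g \<rho> ** Z h) = trace (mat_fun (\<lambda>t. g t * (s * t powr (s - 1))) \<rho> ** X' h)"
      unfolding trZ[OF comm] mat_fun_mult[OF h] ..
    also have "mat_fun (\<lambda>t. g t * (s * t powr (s - 1))) \<rho> = mat_fun (\<lambda>t. z * s * 1) \<rho>"
    proof (rule mat_fun_cong_pos)
      fix t :: real assume "t > 0"
      then have "t powr (1 - s) * t powr (s - 1) = 1" by (simp flip: powr_add)
      then show "g t * (s * t powr (s - 1)) = z * s * 1" unfolding g_def by algebra
    qed (use pd in \<open>simp add: \<rho>_def\<close>)
    also have "\<dots> = (z * s) *\<^sub>R mat 1"
      by (simp only: scaleR_mat_fun[OF h, symmetric] mat_fun_const_1[OF h])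
    also have "2 *\<^sub>R trace ((z * s) *\<^sub>R mat 1 ** X' h) = (2 * (z * s)) *\<^sub>R trace (X' h)"
      by (simp add: matrix_mult_simps trace_scaleR)
    also have "2 * (z * s) = 1 - \<alpha>" using z by (simp add: s_def)
    finally show ?thesis .
  qed
  show "((\<lambda>t. alpha_z_trace \<alpha> z (X t0) (X t)) has_derivative (\<lambda>h. (1 - \<alpha>) * Re (trace (X' h)))) (at t0)"
    using bounded_linear.has_derivative[OF bl W] unfolding Q trWh by simp
qed

text \<open>Only the logarithm of the second argument varies, and the relative entropy is affine in
  it.\<close>

lemma twice_diff_at_relative_entropy:
  fixes X :: "'e::real_normed_vector \<Rightarrow> complex^'n^'n"
  assumes X: "twice_diff_at X t0"
    and herm: "\<forall>\<^sub>F t in nhds t0. hermitian (X t)" and pd: "pos_def (X t0)"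
  shows "twice_diff_at (\<lambda>t. relative_entropy \<rho> (X t)) t0"
proof -
  have "twice_diff_at (\<lambda>t. mat_ln (X t)) t0"
    unfolding mat_ln_def by (rule twice_diff_at_mat_fun[OF disc_analytic_ln X herm pd])
  then have "twice_diff_at (\<lambda>t. mat_ln \<rho> + - mat_ln (X t)) t0"
    by (intro twice_diff_at_add twice_diff_at_const)
      (rule twice_diff_at_linear_compose[OF bounded_linear_minus[OF bounded_linear_ident]])
  then have "twice_diff_at (\<lambda>t. Re (trace (\<rho> ** (mat_ln \<rho> + - mat_ln (X t))))) t0"
    by (rule twice_diff_at_linear_compose[rotated])
      (intro bounded_linear_compose[OF bounded_linear_Re] bounded_linear_compose[OF bounded_linear_trace] bounded_linear_matrix_mult_right)
  then show ?thesis by (simp add: relative_entropy_def)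
qed

section \<open>Matrix inverses\<close>

lemma matrix_inv_eqI:
  fixes A :: "complex^'n^'n"
  assumes "A ** B = mat 1"
  shows "matrix_inv A = B"
proof -
  have "B ** A = mat 1" using assms matrix_left_right_inverse by blast
  then have "A ** matrix_inv A = mat 1 \<and> matrix_inv A ** A = mat 1"
    unfolding matrix_inv_def using assms by (rule_tac someI[of _ B]) simp
  then show ?thesis by (metis \<open>B ** A = mat 1\<close> matrix_mul_assoc matrix_mul_lid matrix_mul_rid)
qed

lemma pos_def_matrix_inv:
  assumes "pos_def A"
  shows "A ** matrix_inv A = mat 1" "matrix_inv A ** A = mat 1"
proof -
  have h: "hermitian A" using assms by (rule pos_def_imp_hermitian)
  have "A ** mat_fun inverse A = mat_fun (\<lambda>t. t * inverse t) A"
    using mat_fun_mult[OF h, of "\<lambda>t. t" inverse] by (simp add: mat_fun_ident[OF h])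
  also have "\<dots> = mat_fun (\<lambda>t. 1) A" by (rule mat_fun_cong_pos[OF assms]) auto
  finally have "A ** mat_fun inverse A = mat 1" by (simp add: mat_fun_const_1[OF h])
  then show "A ** matrix_inv A = mat 1" by (simp add: matrix_inv_eqI)
  then show "matrix_inv A ** A = mat 1" by (simp add: matrix_left_right_inverse)
qed

section \<open>Information matrices of classical-quantum families\<close>

text \<open>Since Q has value 1 and zero gradient at 0, the logarithm has the same second
  derivatives there as Q. This removes the logarithm of a sum over x, and only a sum remains to be
  differentiated.\<close>

lemma alpha_z_information_nth:
  fixes X :: "real^'l \<Rightarrow> complex^'n^'n" and \<alpha> z :: real
  assumes z: "z > 0" and X: "twice_diff_at X \<theta>"
    and pd: "\<forall>\<^sub>F \<eta> in nhds \<theta>. pos_def (X \<eta>)" and tr: "\<forall>\<^sub>F \<eta> in nhds \<theta>. trace (X \<eta>) = 1"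
  defines "Q \<equiv> \<lambda>\<epsilon>. alpha_z_trace \<alpha> z (X \<theta>) (X (\<theta> + \<epsilon>))"
  shows "alpha_z_information \<alpha> z \<theta> X $ i $ j = 1 / (\<alpha> * (\<alpha> - 1)) * hessian i j Q 0"
    and "twice_diff_at Q 0" and "Q 0 = 1" and "partial_deriv k Q 0 = 0"
proof -
  have pd0: "pos_def (X \<theta>)" using pd by (rule eventually_nhds_x_imp_x)
  have tr0: "trace (X \<theta>) = 1" using tr by (rule eventually_nhds_x_imp_x)
  have herm: "\<forall>\<^sub>F \<eta> in nhds \<theta>. hermitian (X \<eta>)" using pd by eventually_elim (rule pos_def_imp_hermitian)
  define R where "R = (\<lambda>\<eta>. alpha_z_trace \<alpha> z (X \<theta>) (X \<eta>))"
  have R: "twice_diff_at R \<theta>"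
    unfolding R_def by (rule twice_diff_at_alpha_z_trace[OF z X herm pd0])
  have QR: "Q = (\<lambda>\<epsilon>. R (\<theta> + \<epsilon>))" by (simp add: Q_def R_def)
  show Q: "twice_diff_at Q 0" unfolding QR by (rule twice_diff_at_shift) (simp add: R)
  show Q0: "Q 0 = 1" by (simp add: Q_def alpha_z_trace_self[OF pd0 z] tr0)
  obtain X' where X': "(X has_derivative X') (at \<theta>)" using X by (rule twice_diff_at_imp_has_derivative)
  have "partial_deriv k (\<lambda>\<eta>. trace (X \<eta>)) \<theta> = 0"
    using partial_deriv_cong[OF tr] by simp
  then have "trace (X' (axis k 1)) = 0" for k
    using partial_deriv_eqI[OF bounded_linear.has_derivative[OF bounded_linear_trace X']]
      partial_deriv_cong[OF tr] by simp
  then have "partial_deriv k R \<theta> = 0" for k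
    using partial_deriv_eqI[OF has_derivative_alpha_z_trace[OF z X herm pd0 X', of \<alpha>]] by (simp add: R_def)
  then have Qk: "partial_deriv k Q 0 = 0" for k by (simp add: QR partial_deriv_shift)
  then show "partial_deriv k Q 0 = 0" .
  have Q0': "Q 0 > 0" by (simp add: Q0)
  have lnQ: "twice_diff_at (\<lambda>\<epsilon>. ln (Q \<epsilon>)) 0"
    by (rule twice_diff_at_compose[OF Q twice_diff_at_ln[OF Q0']])
  have "hessian i j (\<lambda>\<epsilon>. 1 / (\<alpha> - 1) * ln (Q \<epsilon>)) 0 = 1 / (\<alpha> - 1) * hessian i j Q 0"
    unfolding hessian_cmult[OF lnQ] hessian_ln[OF Q Q0'] by (simp add: Q0 Qk)
  then show "alpha_z_information \<alpha> z \<theta> X $ i $ j = 1 / (\<alpha> * (\<alpha> - 1)) * hessian i j Q 0"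
    by (simp add: alpha_z_information_def alpha_z_divergence_eq Q_def)
qed

section \<open>The classical-quantum family and its blocks\<close>

locale cq_family =
  fixes \<Theta> :: "(real^'l) set"
    and ket :: "'x::finite \<Rightarrow> complex^'x"
    and p :: "real^'l \<Rightarrow> 'x \<Rightarrow> real"
    and \<rho> :: "'x \<Rightarrow> real^'l \<Rightarrow> complex^'a^'a"
    and \<rho>XA :: "real^'l \<Rightarrow> complex^('x \<times> 'a)^('x \<times> 'a)"
    and \<theta> :: "real^'l"
  assumes open_domain: "open \<Theta>"
    and ket: "orthonormal_basis ket"
    and p_nonneg: "\<And>\<eta> x. \<eta> \<in> \<Theta> \<Longrightarrow> 0 \<le> p \<eta> x"
    and p_sum: "\<And>\<eta>. \<eta> \<in> \<Theta> \<Longrightarrow> (\<Sum>x\<in>UNIV. p \<eta> x) = 1"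
    and state: "\<And>\<eta> x. \<eta> \<in> \<Theta> \<Longrightarrow> quantum_state (\<rho> x \<eta>)"
    and cq: "\<And>\<eta>. \<eta> \<in> \<Theta> \<Longrightarrow> \<rho>XA \<eta> = cq_state ket (p \<eta>) (\<lambda>x. \<rho> x \<eta>)"
    and pos_def_XA: "\<And>\<eta>. \<eta> \<in> \<Theta> \<Longrightarrow> pos_def (\<rho>XA \<eta>)"
    and twice_diff: "twice_differentiable_on \<rho>XA \<Theta>"
    and \<theta>: "\<theta> \<in> \<Theta>"
begin

lemma ev_domain: "\<forall>\<^sub>F \<eta> in nhds \<theta>. \<eta> \<in> \<Theta>"
  using open_domain \<theta> by (rule eventually_nhds_in_open)

lemma ev_domain_shift: "\<forall>\<^sub>F \<epsilon> in nhds 0. \<theta> + \<epsilon> \<in> \<Theta>"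
proof -
  have "isCont (\<lambda>\<epsilon>. \<theta> + \<epsilon>) 0" by (intro continuous_intros)
  from eventually_nhds_compose[OF this, of "\<lambda>\<eta>. \<eta> \<in> \<Theta>"] ev_domain show ?thesis by simp
qed

lemma trace_state: "\<eta> \<in> \<Theta> \<Longrightarrow> trace (\<rho> x \<eta>) = 1"
  using state by (simp add: quantum_state_def)

lemma block: "\<eta> \<in> \<Theta> \<Longrightarrow> dagger (ket_tensor (ket x)) ** \<rho>XA \<eta> ** ket_tensor (ket x) = p \<eta> x *\<^sub>R \<rho> x \<eta>"
  by (simp add: cq cq_state_eq_cq_block cq_block_block[OF ket])

lemma pos_def_block: "\<eta> \<in> \<Theta> \<Longrightarrow> pos_def (p \<eta> x *\<^sub>R \<rho> x \<eta>)"
  using pos_def_cq_block_block[OF ket, of "\<lambda>x. p \<eta> x *\<^sub>R \<rho> x \<eta>" x] pos_def_XA[of \<eta>]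
  by (simp add: cq cq_state_eq_cq_block)

text \<open>A vanishing weight would make its whole block zero, against positive definiteness of the
  blocks.\<close>

lemma p_pos: assumes "\<eta> \<in> \<Theta>" shows "p \<eta> x > 0"
proof -
  have "p \<eta> x \<noteq> 0"
  proof
    assume "p \<eta> x = 0"
    then have "pos_def (0 :: complex^'a^'a)" using pos_def_block[OF assms, of x] by simp
    \<comment> \<open>Any nonzero vector serves as a witness; \<open>undefined\<close> merely names
      some coordinate.\<close>
    moreover have "(axis undefined 1 :: complex^'a) \<noteq> 0" by simp
    ultimately have "0 < Re (cinner (axis undefined 1) ((0 :: complex^'a^'a) *v axis undefined 1))"
      unfolding pos_def_def by blast
    then show False by (simp add: cinner_def)
  qed
  then show ?thesis using p_nonneg[OF assms, of x] by linarith
qed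

lemma pos_def_state: assumes "\<eta> \<in> \<Theta>" shows "pos_def (\<rho> x \<eta>)"
  using pos_def_scaleR[OF _ pos_def_block[OF assms, of x], of "1 / p \<eta> x"] p_pos[OF assms, of x] by simp

lemma twice_diff_XA: "twice_diff_at \<rho>XA \<theta>"
  using twice_diff open_domain \<theta> by (rule twice_differentiable_on_imp_at)

text \<open>Compression is linear, so the smoothness of \<open>\<rho>XA\<close> passes to each
  weighted block. The trace of the block then yields the weight, and division by the weight the
  conditional state.\<close>

lemma twice_diff_block: "twice_diff_at (\<lambda>\<eta>. p \<eta> x *\<^sub>R \<rho> x \<eta>) \<theta>"
proof (rule twice_diff_at_cong)
  show "\<forall>\<^sub>F \<eta> in nhds \<theta>. dagger (ket_tensor (ket x)) ** \<rho>XA \<eta> ** ket_tensor (ket x) = p \<eta> x *\<^sub>R \<rho> x \<eta>"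
    using ev_domain by eventually_elim (rule block)
  show "twice_diff_at (\<lambda>\<eta>. dagger (ket_tensor (ket x)) ** \<rho>XA \<eta> ** ket_tensor (ket x)) \<theta>"
    by (intro twice_diff_at_bilinear[OF bounded_bilinear_matrix_mult] twice_diff_at_const twice_diff_XA)
qed

lemma twice_diff_p: "twice_diff_at (\<lambda>\<eta>. p \<eta> x) \<theta>"
proof (rule twice_diff_at_cong)
  show "\<forall>\<^sub>F \<eta> in nhds \<theta>. Re (trace (p \<eta> x *\<^sub>R \<rho> x \<eta>)) = p \<eta> x"
    using ev_domain by eventually_elim (simp add: trace_scaleR trace_state)
  show "twice_diff_at (\<lambda>\<eta>. Re (trace (p \<eta> x *\<^sub>R \<rho> x \<eta>))) \<theta>"
    by (rule twice_diff_at_linear_compose[OF _ twice_diff_block])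
      (intro bounded_linear_compose[OF bounded_linear_Re bounded_linear_trace])
qed

lemma twice_diff_p_powr: "twice_diff_at (\<lambda>\<eta>. p \<eta> x powr s) \<theta>"
  by (rule twice_diff_at_compose[OF twice_diff_p twice_diff_at_powr[OF p_pos[OF \<theta>]]])

text \<open>The reciprocal of the weight is written as its power with exponent -1, so that
  smoothness of powers of \<open>p\<close> applies.\<close>

lemma twice_diff_state: "twice_diff_at (\<rho> x) \<theta>"
proof (rule twice_diff_at_cong)
  show "\<forall>\<^sub>F \<eta> in nhds \<theta>. p \<eta> x powr (-1) *\<^sub>R (p \<eta> x *\<^sub>R \<rho> x \<eta>) = \<rho> x \<eta>"
    using ev_domain
  proof eventually_elim
    case (elim \<eta>)
    then show ?case using p_pos[OF elim, of x] by (simp add: powr_minus)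
  qed
  show "twice_diff_at (\<lambda>\<eta>. p \<eta> x powr (-1) *\<^sub>R (p \<eta> x *\<^sub>R \<rho> x \<eta>)) \<theta>"
    by (rule twice_diff_at_bilinear[OF bounded_bilinear_scaleR twice_diff_p_powr twice_diff_block])
qed

lemma trace_XA: "\<eta> \<in> \<Theta> \<Longrightarrow> trace (\<rho>XA \<eta>) = 1"
  using p_sum[of \<eta>]
  by (simp add: cq cq_state_eq_cq_block trace_cq_block[OF ket] trace_scaleR trace_state scaleR_conv_of_real[where 'a=complex]
      flip: of_real_sum)

lemma ev_herm: "\<forall>\<^sub>F \<eta> in nhds \<theta>. hermitian (\<rho> x \<eta>)"
  using ev_domain by eventually_elim (rule pos_def_imp_hermitian[OF pos_def_state])

lemma hessian_p_sum: "(\<Sum>x\<in>UNIV. hessian i j (\<lambda>\<eta>. p \<eta> x) \<theta>) = 0"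
proof -
  have "(\<Sum>x\<in>UNIV. hessian i j (\<lambda>\<eta>. p \<eta> x) \<theta>) = hessian i j (\<lambda>\<eta>. \<Sum>x\<in>UNIV. p \<eta> x) \<theta>"
    by (rule hessian_sum[symmetric]) (simp_all add: twice_diff_p)
  also have "\<dots> = hessian i j (\<lambda>\<eta>. 1) \<theta>"
    by (rule hessian_cong) (rule eventually_mono[OF ev_domain p_sum])
  finally show ?thesis by (simp add: hessian_const)
qed

lemma trace_partial_deriv_state: "trace (partial_deriv k (\<rho> x) \<theta>) = 0"
proof -
  have "trace (partial_deriv k (\<rho> x) \<theta>) = partial_deriv k (\<lambda>\<eta>. trace (\<rho> x \<eta>)) \<theta>"
    by (rule partial_deriv_linear[OF bounded_linear_trace twice_diff_at_differentiable(2)[OF twice_diff_state], symmetric])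
  also have "\<dots> = partial_deriv k (\<lambda>\<eta>. 1) \<theta>"
    by (rule partial_deriv_cong) (rule eventually_mono[OF ev_domain trace_state])
  finally show ?thesis by simp
qed

lemma fisher_nth: "fisher_information \<theta> p $ i $ j =
    (\<Sum>x\<in>UNIV. partial_deriv i (\<lambda>\<eta>. p \<eta> x) \<theta> * partial_deriv j (\<lambda>\<eta>. p \<eta> x) \<theta> / p \<theta> x)"
  by (simp add: fisher_information_def)

lemma alpha_z_information_cq:
  assumes \<alpha>: "0 < \<alpha>" "\<alpha> \<noteq> 1" and z: "0 < z"
  shows "alpha_z_information \<alpha> z \<theta> \<rho>XA =
    fisher_information \<theta> p + (\<Sum>x\<in>UNIV. p \<theta> x *\<^sub>R alpha_z_information \<alpha> z \<theta> (\<rho> x))"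
proof -
  have "alpha_z_information \<alpha> z \<theta> \<rho>XA $ i $ j =
    fisher_information \<theta> p $ i $ j + (\<Sum>x\<in>UNIV. p \<theta> x * alpha_z_information \<alpha> z \<theta> (\<rho> x) $ i $ j)" for i j
  proof -
    define q where "q x = (\<lambda>\<epsilon>. alpha_z_trace \<alpha> z (\<rho> x \<theta>) (\<rho> x (\<theta> + \<epsilon>)))" for x
    define w where "w x = (\<lambda>\<epsilon>. p (\<theta> + \<epsilon>) x powr (1 - \<alpha>))" for x
    define P where "P k x = partial_deriv k (\<lambda>\<eta>. p \<eta> x) \<theta>" for k x
    define H where "H x = hessian i j (\<lambda>\<eta>. p \<eta> x) \<theta>" for x
    have pd: "\<forall>\<^sub>F \<eta> in nhds \<theta>. pos_def (\<rho> x \<eta>)" for x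
      using ev_domain by eventually_elim (rule pos_def_state)
    have tr: "\<forall>\<^sub>F \<eta> in nhds \<theta>. trace (\<rho> x \<eta>) = 1" for x
      using ev_domain by eventually_elim (rule trace_state)
    note q = alpha_z_information_nth[OF z twice_diff_state pd tr, where \<alpha>=\<alpha>, folded q_def]
    have q0: "q x 0 = 1" for x using q(3)[of x] by (simp add: q_def)
    have p0: "p \<theta> x > 0" for x by (rule p_pos[OF \<theta>])
    have w: "twice_diff_at (w x) 0" for x
      unfolding w_def by (rule twice_diff_at_shift) (simp add: twice_diff_p_powr)
    have w0: "w x 0 = p \<theta> x powr (1 - \<alpha>)" for x by (simp add: w_def)
    have wH: "hessian i j (w x) 0 = (1 - \<alpha>) * - \<alpha> * p \<theta> x powr (- 1 - \<alpha>) * P i x * P j x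
        + (1 - \<alpha>) * p \<theta> x powr (- \<alpha>) * H x" for x
      unfolding w_def hessian_shift[where f="\<lambda>\<eta>. p \<eta> x powr (1 - \<alpha>)"]
      using hessian_powr[OF twice_diff_p p0] by (simp add: P_def H_def)
    \<comment> \<open>The exponents \<alpha> and - 1 - \<alpha> add to -1, which gives the Fisher
      term 1 / p. Its coefficient \<alpha> (\<alpha> - 1) is the reciprocal of the prefactor of the
      information matrix, so the Fisher matrix finally enters with coefficient 1.\<close>
    have summand: "hessian i j (\<lambda>\<epsilon>. p \<theta> x powr \<alpha> * (w x \<epsilon> * q x \<epsilon>)) 0 =
      \<alpha> * (\<alpha> - 1) * (P i x * P j x / p \<theta> x) + (1 - \<alpha>) * H x + p \<theta> x * hessian i j (q x) 0" for x
    proof -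
      have "hessian i j (\<lambda>\<epsilon>. p \<theta> x powr \<alpha> * (w x \<epsilon> * q x \<epsilon>)) 0 =
          p \<theta> x powr \<alpha> * (w x 0 * hessian i j (q x) 0 + hessian i j (w x) 0)"
        by (subst hessian_cmult[OF twice_diff_at_bilinear[OF bounded_bilinear_mult w q(2)]])
          (simp add: hessian_mult[OF w q(2)] q0 q(4))
      also have "\<dots> = (p \<theta> x powr \<alpha> * p \<theta> x powr (1 - \<alpha>)) * hessian i j (q x) 0
         + (1 - \<alpha>) * - \<alpha> * (p \<theta> x powr \<alpha> * p \<theta> x powr (- 1 - \<alpha>)) * P i x * P j x
         + (1 - \<alpha>) * (p \<theta> x powr \<alpha> * p \<theta> x powr (- \<alpha>)) * H x"
        unfolding wH w0 by (simp add: algebra_simps)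
      also have "\<dots> = \<alpha> * (\<alpha> - 1) * (P i x * P j x / p \<theta> x) + (1 - \<alpha>) * H x + p \<theta> x * hessian i j (q x) 0"
        using p0[of x] by (simp add: powr_add[symmetric] powr_minus divide_simps) (simp add: algebra_simps)
      finally show ?thesis .
    qed
    have td: "twice_diff_at (\<lambda>\<epsilon>. p \<theta> x powr \<alpha> * (w x \<epsilon> * q x \<epsilon>)) 0" for x
      by (intro twice_diff_at_cmult twice_diff_at_bilinear[OF bounded_bilinear_mult] w q(2))
    have pdX: "\<forall>\<^sub>F \<eta> in nhds \<theta>. pos_def (\<rho>XA \<eta>)"
      using ev_domain by eventually_elim (rule pos_def_XA)
    have trX: "\<forall>\<^sub>F \<eta> in nhds \<theta>. trace (\<rho>XA \<eta>) = 1"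
      using ev_domain by eventually_elim (rule trace_XA)
    have "\<forall>\<^sub>F \<epsilon> in nhds 0. alpha_z_trace \<alpha> z (\<rho>XA \<theta>) (\<rho>XA (\<theta> + \<epsilon>)) =
       (\<Sum>x\<in>UNIV. p \<theta> x powr \<alpha> * (w x \<epsilon> * q x \<epsilon>))"
      using ev_domain_shift
    proof eventually_elim
      case (elim \<epsilon>)
      show ?case
        unfolding cq[OF \<theta>] cq[OF elim] w_def q_def
        by (rule alpha_z_trace_cq[OF ket z]) (simp_all add: p_pos pos_def_state \<theta> elim)
    qed
    then have "hessian i j (\<lambda>\<epsilon>. alpha_z_trace \<alpha> z (\<rho>XA \<theta>) (\<rho>XA (\<theta> + \<epsilon>))) 0 =
       (\<Sum>x\<in>UNIV. hessian i j (\<lambda>\<epsilon>. p \<theta> x powr \<alpha> * (w x \<epsilon> * q x \<epsilon>)) 0)"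
      by (subst hessian_sum[OF td, symmetric]) (auto intro: hessian_cong)
    also have "\<dots> = \<alpha> * (\<alpha> - 1) * (\<Sum>x\<in>UNIV. P i x * P j x / p \<theta> x) + (1 - \<alpha>) * (\<Sum>x\<in>UNIV. H x)
        + (\<Sum>x\<in>UNIV. p \<theta> x * hessian i j (q x) 0)"
      by (simp add: summand sum.distrib sum_distrib_left)
    also have "(\<Sum>x\<in>UNIV. H x) = 0" unfolding H_def by (rule hessian_p_sum)
    finally have "alpha_z_information \<alpha> z \<theta> \<rho>XA $ i $ j = (\<Sum>x\<in>UNIV. P i x * P j x / p \<theta> x)
        + 1 / (\<alpha> * (\<alpha> - 1)) * (\<Sum>x\<in>UNIV. p \<theta> x * hessian i j (q x) 0)"
      using \<alpha> by (simp add: alpha_z_information_nth(1)[OF z twice_diff_XA pdX trX] distrib_left)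
    then show ?thesis
      by (simp add: fisher_nth P_def q(1) sum_distrib_left mult_ac)
  qed
  then show ?thesis by (simp add: vec_eq_iff)
qed

text \<open>Weight and state enter additively here, so there are no mixed terms: the Fisher matrix
  is the second derivative of - p ln p(\<theta> + \<epsilon>), with the outer weight frozen at
  \<theta>.\<close>

lemma KM_information_cq:
  "KM_information \<theta> \<rho>XA = fisher_information \<theta> p + (\<Sum>x\<in>UNIV. p \<theta> x *\<^sub>R KM_information \<theta> (\<rho> x))"
proof -
  have "KM_information \<theta> \<rho>XA $ i $ j =
    fisher_information \<theta> p $ i $ j + (\<Sum>x\<in>UNIV. p \<theta> x * KM_information \<theta> (\<rho> x) $ i $ j)" for i j
  proof -
    define r where "r x = (\<lambda>\<epsilon>. relative_entropy (\<rho> x \<theta>) (\<rho> x (\<theta> + \<epsilon>)))" for x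
    define l where "l x = (\<lambda>\<epsilon>. ln (p (\<theta> + \<epsilon>) x))" for x
    define P where "P k x = partial_deriv k (\<lambda>\<eta>. p \<eta> x) \<theta>" for k x
    define H where "H x = hessian i j (\<lambda>\<eta>. p \<eta> x) \<theta>" for x
    have p0: "p \<theta> x > 0" for x by (rule p_pos[OF \<theta>])
    have r: "twice_diff_at (r x) 0" for x
      unfolding r_def
      by (rule twice_diff_at_shift[where f="\<lambda>\<eta>. relative_entropy (\<rho> x \<theta>) (\<rho> x \<eta>)"])
        (simp add: twice_diff_at_relative_entropy twice_diff_state ev_herm pos_def_state \<theta>)
    have l: "twice_diff_at (l x) 0" for x
      unfolding l_def
      by (rule twice_diff_at_shift[where f="\<lambda>\<eta>. ln (p \<eta> x)"])
        (simp add: twice_diff_at_compose[OF twice_diff_p twice_diff_at_ln[OF p0]])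
    have lH: "hessian i j (l x) 0 = H x / p \<theta> x - P i x * P j x / (p \<theta> x)\<^sup>2" for x
      unfolding l_def hessian_shift[where f="\<lambda>\<eta>. ln (p \<eta> x)"]
      using hessian_ln[OF twice_diff_p p0] by (simp add: P_def H_def)
    define T where "T x = (\<lambda>\<epsilon>. p \<theta> x * ln (p \<theta> x) + (- p \<theta> x * l x \<epsilon> + p \<theta> x * r x \<epsilon>))" for x
    have T: "twice_diff_at (T x) 0" for x
      unfolding T_def by (intro twice_diff_at_add twice_diff_at_const twice_diff_at_cmult l r)
    have TH: "hessian i j (T x) 0 = P i x * P j x / p \<theta> x - H x + p \<theta> x * hessian i j (r x) 0" for x
    proof -
      have "hessian i j (T x) 0 = - p \<theta> x * hessian i j (l x) 0 + p \<theta> x * hessian i j (r x) 0"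
        unfolding T_def
        by (simp only: hessian_add twice_diff_at_add twice_diff_at_const twice_diff_at_cmult l r
            hessian_const hessian_cmult add_0_left)
      also have "\<dots> = P i x * P j x / p \<theta> x - H x + p \<theta> x * hessian i j (r x) 0"
        unfolding lH using p0[of x] by (simp add: power2_eq_square field_simps)
      finally show ?thesis .
    qed
    have "\<forall>\<^sub>F \<epsilon> in nhds 0. relative_entropy (\<rho>XA \<theta>) (\<rho>XA (\<theta> + \<epsilon>)) = (\<Sum>x\<in>UNIV. T x \<epsilon>)"
      using ev_domain_shift
    proof eventually_elim
      case (elim \<epsilon>)
      have "relative_entropy (\<rho>XA \<theta>) (\<rho>XA (\<theta> + \<epsilon>)) =
          (\<Sum>x\<in>UNIV. p \<theta> x * (ln (p \<theta> x) - ln (p (\<theta> + \<epsilon>) x)) + p \<theta> x * relative_entropy (\<rho> x \<theta>) (\<rho> x (\<theta> + \<epsilon>)))"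
        unfolding cq[OF \<theta>] cq[OF elim]
        by (rule relative_entropy_cq[OF ket]) (simp_all add: p_pos pos_def_state trace_state \<theta> elim)
      then show ?case by (simp add: T_def l_def r_def algebra_simps)
    qed
    then have "KM_information \<theta> \<rho>XA $ i $ j = (\<Sum>x\<in>UNIV. hessian i j (T x) 0)"
      by (subst hessian_sum[OF T, symmetric]) (auto simp: KM_information_def intro: hessian_cong)
    also have "\<dots> = (\<Sum>x\<in>UNIV. P i x * P j x / p \<theta> x) - (\<Sum>x\<in>UNIV. H x) + (\<Sum>x\<in>UNIV. p \<theta> x * hessian i j (r x) 0)"
      by (simp add: TH sum.distrib sum_subtractf)
    also have "(\<Sum>x\<in>UNIV. H x) = 0" unfolding H_def by (rule hessian_p_sum)
    finally show ?thesis by (simp add: fisher_nth P_def KM_information_def r_def)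
  qed
  then show ?thesis by (simp add: vec_eq_iff)
qed

text \<open>The basis does not depend on the parameter, so differentiation acts inside the
  blocks.\<close>

lemma partial_deriv_XA:
  "partial_deriv k \<rho>XA \<theta> = cq_block ket (\<lambda>x. partial_deriv k (\<lambda>\<eta>. p \<eta> x *\<^sub>R \<rho> x \<eta>) \<theta>)"
proof -
  let ?B = "\<lambda>x \<eta>. p \<eta> x *\<^sub>R \<rho> x \<eta>"
  have "partial_deriv k \<rho>XA \<theta> = partial_deriv k (\<lambda>\<eta>. \<Sum>x\<in>UNIV. ket_tensor (ket x) ** ?B x \<eta> ** dagger (ket_tensor (ket x))) \<theta>"
    by (rule partial_deriv_cong) (use ev_domain in \<open>eventually_elim, simp add: cq cq_state_eq_cq_block cq_block_def\<close>)
  also have "\<dots> = (\<Sum>x\<in>UNIV. partial_deriv k (\<lambda>\<eta>. ket_tensor (ket x) ** ?B x \<eta> ** dagger (ket_tensor (ket x))) \<theta>)"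
    by (intro partial_deriv_sum differentiable_bilinear[OF bounded_bilinear_matrix_mult] differentiable_const
        twice_diff_at_differentiable(2)[OF twice_diff_block])
  also have "\<dots> = (\<Sum>x\<in>UNIV. ket_tensor (ket x) ** partial_deriv k (?B x) \<theta> ** dagger (ket_tensor (ket x)))"
    by (intro sum.cong refl partial_deriv_linear[where h="\<lambda>B. ket_tensor _ ** B ** dagger (ket_tensor _)"]
        bounded_linear_compose[OF bounded_linear_matrix_mult_left bounded_linear_matrix_mult_right] twice_diff_at_differentiable(2)[OF twice_diff_block])
  finally show ?thesis by (simp add: cq_block_def)
qed

text \<open>In each block the derivative is p D + P \<rho> and the inverse is M / p with M the
  inverse of \<rho>. On expanding the product, D D M keeps the weight p, \<rho> \<rho> M has trace 1
  and gives the Fisher term, and the mixed terms are treated in \<open>DM\<close>.\<close>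

lemma RLD_information_cq:
  "RLD_information \<theta> \<rho>XA = fisher_information \<theta> p + (\<Sum>x\<in>UNIV. p \<theta> x *\<^sub>R RLD_information \<theta> (\<rho> x))"
proof -
  have "RLD_information \<theta> \<rho>XA $ i $ j =
    fisher_information \<theta> p $ i $ j + (\<Sum>x\<in>UNIV. p \<theta> x * RLD_information \<theta> (\<rho> x) $ i $ j)" for i j
  proof -
    define P where "P k x = partial_deriv k (\<lambda>\<eta>. p \<eta> x) \<theta>" for k x
    define D where "D k x = partial_deriv k (\<rho> x) \<theta>" for k x
    define B where "B k x = partial_deriv k (\<lambda>\<eta>. p \<eta> x *\<^sub>R \<rho> x \<eta>) \<theta>" for k x
    define M where "M x = matrix_inv (\<rho> x \<theta>)" for x
    have p0: "p \<theta> x > 0" for x by (rule p_pos[OF \<theta>])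
    have M: "\<rho> x \<theta> ** M x = mat 1" "M x ** \<rho> x \<theta> = mat 1" for x
      unfolding M_def using pos_def_matrix_inv[OF pos_def_state[OF \<theta>]] by blast+
    have B: "B k x = p \<theta> x *\<^sub>R D k x + P k x *\<^sub>R \<rho> x \<theta>" for k x
      unfolding B_def D_def P_def
      by (intro partial_deriv_bilinear[OF bounded_bilinear_scaleR] twice_diff_at_differentiable(2)
          twice_diff_p twice_diff_state)
    have inv: "matrix_inv (\<rho>XA \<theta>) = cq_block ket (\<lambda>x. (1 / p \<theta> x) *\<^sub>R M x)"
    proof (rule matrix_inv_eqI)
      have "p \<theta> x \<noteq> 0" for x using p0[of x] by simp
      then show "\<rho>XA \<theta> ** cq_block ket (\<lambda>x. (1 / p \<theta> x) *\<^sub>R M x) = mat 1"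
        by (simp add: cq[OF \<theta>] cq_state_eq_cq_block cq_block_mult[OF ket] matrix_mult_simps M cq_block_mat_1[OF ket])
    qed
    have add: "cq_block ket F + cq_block ket G = cq_block ket (\<lambda>x. F x + G x)" for F G :: "_ \<Rightarrow> complex^'a^'a"
      by (simp add: cq_block_def matrix_mult_simps sum.distrib)
    \<comment> \<open>In either order M cancels \<rho>, once after a cyclic shift. What remains is
      the trace of D, which is zero because the states have constant trace.\<close>
    have DM: "trace (\<rho> x \<theta> ** D k x ** M x) = 0" "trace (D k x ** \<rho> x \<theta> ** M x) = 0" for k x
    proof -
      have "trace (\<rho> x \<theta> ** D k x ** M x) = trace (D k x ** (M x ** \<rho> x \<theta>))"
        by (metis matrix_mul_assoc trace_mult_commute)
      then show "trace (\<rho> x \<theta> ** D k x ** M x) = 0" by (simp add: M D_def trace_partial_deriv_state)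
      have "D k x ** \<rho> x \<theta> ** M x = D k x" by (simp add: M flip: matrix_mul_assoc)
      then show "trace (D k x ** \<rho> x \<theta> ** M x) = 0" by (simp add: D_def trace_partial_deriv_state)
    qed
    have RM: "trace (\<rho> x \<theta> ** \<rho> x \<theta> ** M x) = 1" for x
      by (simp add: M trace_state[OF \<theta>] flip: matrix_mul_assoc)
    \<comment> \<open>Stated for one order of the factors; both orders together give the
      anticommutator, and the two equal Fisher terms cancel the factor 1 / 2.\<close>
    have prod: "trace (B k x ** B m x ** ((1 / p \<theta> x) *\<^sub>R M x)) =
       p \<theta> x *\<^sub>R trace (D k x ** D m x ** M x) + (P k x * P m x / p \<theta> x) *\<^sub>R 1" for k m x
      using p0[of x]
      by (simp add: B matrix_mult_simps trace_add trace_scaleR DM RM field_simps)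
    have block: "Re (trace ((B i x ** B j x + B j x ** B i x) ** ((1 / p \<theta> x) *\<^sub>R M x))) =
       2 * (P i x * P j x / p \<theta> x) + p \<theta> x * Re (trace ((D i x ** D j x + D j x ** D i x) ** M x))" for x
    proof -
      have "trace ((B i x ** B j x + B j x ** B i x) ** ((1 / p \<theta> x) *\<^sub>R M x)) =
        trace (B i x ** B j x ** ((1 / p \<theta> x) *\<^sub>R M x)) + trace (B j x ** B i x ** ((1 / p \<theta> x) *\<^sub>R M x))"
        by (simp add: matrix_mult_simps trace_add trace_scaleR scaleR_right_distrib)
      then show ?thesis
        unfolding prod by (simp add: matrix_mult_simps trace_add algebra_simps)
    qed
    have "RLD_information \<theta> \<rho>XA $ i $ j =
      1 / 2 * (\<Sum>x\<in>UNIV. Re (trace ((B i x ** B j x + B j x ** B i x) ** ((1 / p \<theta> x) *\<^sub>R M x))))"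
      by (simp only: RLD_information_def vec_lambda_beta partial_deriv_XA B_def[symmetric] inv cq_block_mult[OF ket] add
          trace_cq_block[OF ket] Re_sum)
    also have "\<dots> = (\<Sum>x\<in>UNIV. P i x * P j x / p \<theta> x)
        + (\<Sum>x\<in>UNIV. p \<theta> x * (1 / 2 * Re (trace ((D i x ** D j x + D j x ** D i x) ** M x))))"
      unfolding block sum_distrib_left sum.distrib[symmetric] by (rule sum.cong) (auto simp: algebra_simps)
    finally show ?thesis
      by (simp add: fisher_nth P_def D_def M_def RLD_information_def)
  qed
  then show ?thesis by (simp add: vec_eq_iff)
qed

end

theorem theorem40:
  fixes \<Theta> :: "(real^'l) set"
    and ket :: "'x::finite \<Rightarrow> complex^'x"
    and p :: "real^'l \<Rightarrow> 'x \<Rightarrow> real"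
    and \<rho> :: "'x \<Rightarrow> real^'l \<Rightarrow> complex^'a^'a"
    and \<rho>XA :: "real^'l \<Rightarrow> complex^('x \<times> 'a)^('x \<times> 'a)"
    and \<theta> :: "real^'l"
  assumes "open \<Theta>"
    and "orthonormal_basis ket"
    and "\<And>\<eta> x. \<eta> \<in> \<Theta> \<Longrightarrow> 0 \<le> p \<eta> x"
    and "\<And>\<eta>. \<eta> \<in> \<Theta> \<Longrightarrow> (\<Sum>x\<in>UNIV. p \<eta> x) = 1"
    and "\<And>\<eta> x. \<eta> \<in> \<Theta> \<Longrightarrow> quantum_state (\<rho> x \<eta>)"
    and "\<And>\<eta>. \<eta> \<in> \<Theta> \<Longrightarrow> \<rho>XA \<eta> = cq_state ket (p \<eta>) (\<lambda>x. \<rho> x \<eta>)"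
    and "\<And>\<eta>. \<eta> \<in> \<Theta> \<Longrightarrow> pos_def (\<rho>XA \<eta>)"
    and "twice_differentiable_on \<rho>XA \<Theta>"
    and "\<theta> \<in> \<Theta>"
  shows "(\<forall>\<alpha> z. \<alpha> \<in> {0<..<1} \<union> {1<..} \<and> 0 < z \<longrightarrow>
            alpha_z_information \<alpha> z \<theta> \<rho>XA =
              fisher_information \<theta> p +
              (\<Sum>x\<in>UNIV. p \<theta> x *\<^sub>R alpha_z_information \<alpha> z \<theta> (\<rho> x))) \<and>
         KM_information \<theta> \<rho>XA =
           fisher_information \<theta> p + (\<Sum>x\<in>UNIV. p \<theta> x *\<^sub>R KM_information \<theta> (\<rho> x)) \<and>
         RLD_information \<theta> \<rho>XA =
           fisher_information \<theta> p + (\<Sum>x\<in>UNIV. p \<theta> x *\<^sub>R RLD_information \<theta> (\<rho> x))"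
proof -
  interpret cq_family \<Theta> ket p \<rho> \<rho>XA \<theta>
    by unfold_locales (fact assms)+
  show ?thesis
    using alpha_z_information_cq KM_information_cq RLD_information_cq by auto
qed

end
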